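(* Let $\varepsilon,\gamma,\gamma'\in(0,1]$ with $\gamma>\gamma'$. There is an $\varepsilon$-$\nabla_0$DP algorithm $M:\mathcal{X}^n\to\mathcal{H}_{\mathrm{halfspace}}$, where $\mathcal{X}=\{-1,+1\}^d\times\{-1,+1\}$, such that for every distribution $\mathcal{D}$ on $\mathcal{X}$, if $S\sim\mathcal{D}^n$ then $$\mathbb{E}[\mathcal{R}_{\gamma'}(M(S),\mathcal{D})]\le\inf_{h\in\mathcal{H}_{\mathrm{halfspace}}}\mathcal{R}_\gamma(h,\mathcal{D})+O\!\left(\frac{1}{\varepsilon\sqrt n(\gamma-\gamma')^2}+\frac{\log(1/(\gamma-\gamma'))}{\varepsilon^2n(\gamma-\gamma')}\right),$$ where the $O(\cdot)$ hides an absolute constant.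
   Context: A halfspace is $h_w(x)=\mathrm{sgn}(\langle w,x\rangle)$ for $w\in\mathbb{R}^d$; $\mathcal{H}_{\mathrm{halfspace}}=\{h_w:w\in\mathbb{R}^d\}$. For a distribution $\mathcal{D}$ on $\{-1,+1\}^d\times\{-1,+1\}$ and $h:\{-1,+1\}^d\to\{-1,+1\}$, the $\gamma$-robust error is $\mathcal{R}_\gamma(h,\mathcal{D})=\Pr_{(x,y)\sim\mathcal{D}}[\exists\check x\in\{-1,+1\}^d:\ h(\check x)\ne y\ \wedge\ \|\check x-x\|_0\le\gamma d]$, where $\|\cdot\|_0$ is Hamming distance. For privacy, each record $(x_i,y_i)$ is viewed as having $d+1$ attributes (coordinates of $x_i$ and the label); $M$ is $\varepsilon$-$\nabla_0$DP if for all datasets $S,S'$ differing only in record $i$ and all measurable sets $E$, $\Pr[M(S)\in E]\le e^{\varepsilon\cdot k}\Pr[M(S')\in E]$, where $k$ is the number of attributes on which records $i$ of $S$ and $S'$ differ. *)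

theory Defs
  imports "HOL-Probability.Probability"
begin

definition cube :: "nat \<Rightarrow> int list set" where
  "cube d = {x. length x = d \<and> set x \<subseteq> {-1, 1}}"

definition recdom :: "nat \<Rightarrow> (int list \<times> int) set" where
  "recdom d = cube d \<times> {-1, 1}"

definition hamming :: "'a list \<Rightarrow> 'a list \<Rightarrow> nat" where
  "hamming x y = card {i. i < length x \<and> i < length y \<and> x ! i \<noteq> y ! i}"

definition halfspace :: "real list \<Rightarrow> int list \<Rightarrow> int" where
  "halfspace w x = (if (\<Sum>i<length w. w ! i * real_of_int (x ! i)) \<ge> 0 then 1 else -1)"

definition halfspaces :: "nat \<Rightarrow> (int list \<Rightarrow> int) set" where
  "halfspaces d = {halfspace w | w. length w = d}"

definition robust_err :: "nat \<Rightarrow> real \<Rightarrow> (int list \<Rightarrow> int) \<Rightarrow> (int list \<times> int) pmf \<Rightarrow> real" where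
  "robust_err d \<gamma> h D = measure_pmf.prob D
     {(x, y). \<exists>x' \<in> cube d. h x' \<noteq> y \<and> real (hamming x' x) \<le> \<gamma> * real d}"

definition attr_dist :: "int list \<times> int \<Rightarrow> int list \<times> int \<Rightarrow> nat" where
  "attr_dist r r' = hamming (fst r) (fst r') + (if snd r \<noteq> snd r' then 1 else 0)"

definition attr_dp :: "real \<Rightarrow> nat \<Rightarrow> nat \<Rightarrow> ((int list \<times> int) list \<Rightarrow> 'h pmf) \<Rightarrow> bool" where
  "attr_dp \<epsilon> d n M \<longleftrightarrow>
     (\<forall>S S' i E. length S = n \<and> length S' = n \<and> set S \<subseteq> recdom d \<and> set S' \<subseteq> recdom d \<and>
        i < n \<and> (\<forall>j<n. j \<noteq> i \<longrightarrow> S ! j = S' ! j) \<longrightarrow>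
        measure_pmf.prob (M S) E \<le> exp (\<epsilon> * real (attr_dist (S ! i) (S' ! i))) * measure_pmf.prob (M S') E)"

end

theory Submission
  imports Defs
begin

text \<open>
  The labels are privatised by randomized response and debiased, which costs a factor of order
  \<open>1 / \<epsilon>\<close>; a hypothesis is then selected by the exponential mechanism. What makes the error free of
  the dimension is that robustness gives margins. If a halfspace resists \<open>\<gamma> d\<close> flips, its
  \<open>(\<gamma> - \<gamma>') d\<close> heaviest coordinates can be dropped; after scaling the remaining weights into
  \<open>[-1, 1]\<close> and rounding them, it still has margin of order \<open>(\<gamma> - \<gamma>') d\<close> against \<open>\<gamma>' d\<close> flips. By Chebyshev
  such a margin is visible on about \<open>1 / (\<gamma> - \<gamma>')\<^sup>2\<close> random coordinates, so the score of a weight vector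
  is taken to be the probability that its restriction to random coordinates looks fragile. This score
  changes by \<open>O(1 / d)\<close> per attribute, up to powers of \<open>\<gamma> - \<gamma>'\<close>, which pays for the \<open>exp (O(d))\<close> candidates;
  and it is an average of functions of boundedly many coordinates, so symmetrization, contraction (for the ramp
  that turns the score into a loss) and the finite class lemma bound the generalization error independently of \<open>d\<close>.
  When \<open>(\<gamma> - \<gamma>') d < 2\<close> the exact robust loss is used, with one halfspace per vector of Chow parameters.
  If \<open>\<epsilon> (\<gamma> - \<gamma>')\<^sup>2 * sqrt n < 1\<close> the bound is trivial; otherwise all other error terms are dominated by the first one.
\<close>

section \<open>Rademacher averages\<close>

text \<open>For \<open>x \<ge> 0\<close> this is the inequality behind Hoeffding's lemma at success
  probability 1/2 and length \<open>2 * x\<close>, since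
  \<open>1 + (exp (2 * x) - 1) / 2 = exp x * cosh x\<close>. Evenness gives the rest.\<close>

lemma cosh_le_exp_half_square:
  fixes x :: real
  shows "cosh x \<le> exp (x\<^sup>2 / 2)"
proof -
  have *: "cosh x \<le> exp (x\<^sup>2 / 2)" if "x \<ge> 0" for x :: real
  proof -
    have e: "exp (2 * x) = exp x * exp x" using exp_double[of x] by (simp only: power2_eq_square)
    have "-(2 * x) * (1/2) + ln (1 + (1/2) * (exp (2 * x) - 1)) \<le> (2 * x)\<^sup>2 / 8"
      using Hoeffdings_lemma_aux[of "2 * x" "1/2"] that by simp
    moreover have "1 + (1/2) * (exp (2 * x) - 1) = exp x * cosh x"
      unfolding e cosh_field_def exp_minus by (simp add: field_simps)
    moreover have "ln (exp x * cosh x) = x + ln (cosh x)"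
      using cosh_real_pos[of x] by (simp add: ln_mult)
    ultimately have "ln (cosh x) \<le> x\<^sup>2 / 2" by (simp add: power2_eq_square)
    then have "exp (ln (cosh x)) \<le> exp (x\<^sup>2 / 2)" by (simp only: exp_le_cancel_iff)
    then show ?thesis using cosh_real_pos[of x] by simp
  qed
  show ?thesis using *[of x] *[of "-x"] by (cases "x \<ge> 0") auto
qed

text \<open>The expectation, over independent uniform signs \<open>\<sigma>\<close>, of the maximum over \<open>h\<close> of
  \<open>A h + \<Sum> \<sigma>\<^sub>i * g\<^sub>i h\<close>.\<close>
fun rad :: "'h set \<Rightarrow> ('h \<Rightarrow> real) list \<Rightarrow> ('h \<Rightarrow> real) \<Rightarrow> real" where
  "rad H [] A = Max (A ` H)"
| "rad H (g # gs) A = (rad H gs (\<lambda>h. A h + g h) + rad H gs (\<lambda>h. A h - g h)) / 2"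

text \<open>Convexity of \<open>rad\<close>: the maximum of a sum is at most the sum of the maxima,
  and averaging over signs is linear. It serves for Jensen's inequality, for the average over
  projections and for the four terms of the debiased loss.\<close>

lemma rad_weighted_sum_le:
  assumes H: "finite H" "H \<noteq> {}" and p: "\<And>i. i \<in> I \<Longrightarrow> p i \<ge> 0"
  shows "rad H (map (\<lambda>z h. \<Sum>i\<in>I. p i * f i z h) zs) (\<lambda>h. \<Sum>i\<in>I. p i * A i h)
    \<le> (\<Sum>i\<in>I. p i * rad H (map (f i) zs) (A i))"
proof (induction zs arbitrary: A)
  case Nil
  have "(\<Sum>i\<in>I. p i * A i h) \<le> (\<Sum>i\<in>I. p i * Max (A i ` H))" if "h \<in> H" for h
    using H p that by (intro sum_mono mult_left_mono Max_ge) auto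
  then show ?case using H by (auto intro!: Max.boundedI)
next
  case (Cons z zs)
  let ?F = "map (\<lambda>z h. \<Sum>i\<in>I. p i * f i z h) zs"
  have "rad H ?F (\<lambda>h. \<Sum>i\<in>I. p i * (A i h + f i z h)) + rad H ?F (\<lambda>h. \<Sum>i\<in>I. p i * (A i h - f i z h))
    \<le> (\<Sum>i\<in>I. p i * (rad H (map (f i) zs) (\<lambda>h. A i h + f i z h) + rad H (map (f i) zs) (\<lambda>h. A i h - f i z h)))"
    using Cons[of "\<lambda>i h. A i h + f i z h"] Cons[of "\<lambda>i h. A i h - f i z h"]
    by (simp add: sum.distrib distrib_left)
  then show ?case
    by (simp add: sum.distrib sum_subtractf distrib_left right_diff_distrib add_divide_distrib
        sum_divide_distrib[symmetric])
qed

text \<open>The comparison step of Talagrand's contraction principle. If \<open>h\<close> and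
  \<open>h'\<close> attain the two maxima, the left side is
  \<open>A h + A h' + (\<phi> h - \<phi> h')\<close>. The last bracket is at most
  \<open>\<bar>g h - g h'\<bar>\<close>, and either sign of \<open>g h - g h'\<close> is realised on
  the right, because \<open>g\<close> occurs there with both signs. The remaining signs are common
  to both halves, which allows the induction.\<close>

lemma rad_replace_first_le:
  assumes H: "finite H" "H \<noteq> {}"
    and le: "\<And>h h'. h \<in> H \<Longrightarrow> h' \<in> H \<Longrightarrow> \<bar>\<phi> h - \<phi> h'\<bar> \<le> \<bar>g h - g h'\<bar>"
  shows "rad H (\<phi> # gs) A \<le> rad H (g # gs) A"
proof -
  have "rad H gs (\<lambda>h. A h + \<phi> h) + rad H gs (\<lambda>h. A h - \<phi> h)
      \<le> rad H gs (\<lambda>h. A h + g h) + rad H gs (\<lambda>h. A h - g h)"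
  proof (induction gs arbitrary: A)
    case Nil
    have "Max ((\<lambda>h. A h + \<phi> h) ` H) \<in> (\<lambda>h. A h + \<phi> h) ` H"
         "Max ((\<lambda>h. A h - \<phi> h) ` H) \<in> (\<lambda>h. A h - \<phi> h) ` H"
      using H by (auto intro!: Max_in)
    then obtain h h' where h: "h \<in> H" "h' \<in> H"
      "Max ((\<lambda>h. A h + \<phi> h) ` H) = A h + \<phi> h" "Max ((\<lambda>h. A h - \<phi> h) ` H) = A h' - \<phi> h'"
      by auto
    have "A h'' + g h'' \<le> Max ((\<lambda>h. A h + g h) ` H)"
         "A h'' - g h'' \<le> Max ((\<lambda>h. A h - g h) ` H)" if "h'' \<in> H" for h''
      using H that by (auto intro!: Max_ge)
    from this[OF h(1)] this[OF h(2)] le[OF h(1,2)] h(3,4) show ?case by simp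
  next
    case (Cons k gs)
    let ?r = "rad H gs"
    have "?r (\<lambda>h. A h + \<phi> h + k h) + ?r (\<lambda>h. A h - \<phi> h + k h)
        \<le> ?r (\<lambda>h. A h + g h + k h) + ?r (\<lambda>h. A h - g h + k h)"
      using Cons[of "\<lambda>h. A h + k h"] by (simp add: algebra_simps)
    moreover have "?r (\<lambda>h. A h + \<phi> h - k h) + ?r (\<lambda>h. A h - \<phi> h - k h)
        \<le> ?r (\<lambda>h. A h + g h - k h) + ?r (\<lambda>h. A h - g h - k h)"
      using Cons[of "\<lambda>h. A h - k h"] by (simp add: algebra_simps)
    ultimately show ?case unfolding rad.simps by (simp add: field_simps)
  qed
  then show ?thesis by simp
qed

lemma rad_contraction:
  assumes H: "finite H" "H \<noteq> {}"
    and le: "\<And>z h h'. z \<in> set zs \<Longrightarrow> h \<in> H \<Longrightarrow> h' \<in> H \<Longrightarrow> \<bar>\<phi> z h - \<phi> z h'\<bar> \<le> \<bar>g z h - g z h'\<bar>"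
  shows "rad H (map \<phi> zs) A \<le> rad H (map g zs) A"
  using le
proof (induction zs arbitrary: A)
  case (Cons z zs)
  have "rad H (map \<phi> (z # zs)) A \<le> rad H (\<phi> z # map g zs) A"
    using Cons.IH[OF Cons.prems, of "\<lambda>h. A h + \<phi> z h"] Cons.IH[OF Cons.prems, of "\<lambda>h. A h - \<phi> z h"]
    by simp
  also have "\<dots> \<le> rad H (g z # map g zs) A"
    using H Cons.prems by (intro rad_replace_first_le) auto
  finally show ?case by simp
qed auto

text \<open>Only the values of \<open>\<pi>\<close> matter, so the finite class lemma may be applied
  to the image, which can be far smaller than \<open>H\<close>.\<close>

lemma rad_reindex: "rad H (map (\<lambda>z h. g z (\<pi> h)) zs) (\<lambda>h. A (\<pi> h)) = rad (\<pi> ` H) (map g zs) A"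
proof (induction zs arbitrary: A)
  case (Cons z zs)
  from Cons[of "\<lambda>h. A h + g z h"] Cons[of "\<lambda>h. A h - g z h"] show ?case by simp
qed (simp add: image_image)

text \<open>The moment bound behind Massart's lemma: convexity of \<open>exp\<close> moves each sign
  average outside, the maximum is replaced by a sum over \<open>H\<close>, and each sign contributes
  a factor \<open>cosh (l * g z h)\<close>.\<close>

lemma exp_rad_le:
  assumes H: "finite H" "H \<noteq> {}"
    and g: "\<And>z h. z \<in> set zs \<Longrightarrow> h \<in> H \<Longrightarrow> \<bar>g z h\<bar> \<le> 1"
  shows "exp (l * rad H (map g zs) A) \<le> (\<Sum>h\<in>H. exp (l * A h)) * exp (l\<^sup>2 / 2) ^ length zs"
  using g
proof (induction zs arbitrary: A)
  case Nil
  have "Max (A ` H) \<in> A ` H" using H by (intro Max_in) auto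
  then obtain h where "h \<in> H" "Max (A ` H) = A h" by auto
  then show ?case using H by (auto intro!: member_le_sum[of h H "\<lambda>h. exp (l * A h)"])
next
  case (Cons z zs)
  let ?a = "rad H (map g zs) (\<lambda>h. A h + g z h)" and ?b = "rad H (map g zs) (\<lambda>h. A h - g z h)"
  let ?c = "exp (l\<^sup>2 / 2)"
  \<comment> \<open>Midpoint convexity of \<open>exp\<close>, by expanding a square.\<close>
  have am: "exp ((x + y) / 2) \<le> (exp x + exp y) / 2" for x y :: real
  proof -
    have "0 \<le> (exp (x/2) - exp (y/2))\<^sup>2" by simp
    also have "\<dots> = exp x + exp y - 2 * exp ((x + y) / 2)"
      using exp_double[of "x/2"] exp_double[of "y/2"]
      by (simp add: power2_diff add_divide_distrib exp_add)
    finally show ?thesis by simp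
  qed
  have "exp (l * rad H (map g (z # zs)) A) = exp ((l * ?a + l * ?b) / 2)"
    by (simp add: algebra_simps)
  also have "\<dots> \<le> (exp (l * ?a) + exp (l * ?b)) / 2" by (rule am)
  also have "\<dots> \<le> ((\<Sum>h\<in>H. exp (l * (A h + g z h))) * ?c ^ length zs
      + (\<Sum>h\<in>H. exp (l * (A h - g z h))) * ?c ^ length zs) / 2"
    using Cons by (intro divide_right_mono add_mono) auto
  also have "\<dots> = (\<Sum>h\<in>H. exp (l * A h) * cosh (l * g z h)) * ?c ^ length zs"
  proof -
    have "exp (l * (A h + g z h)) + exp (l * (A h - g z h)) = 2 * (exp (l * A h) * cosh (l * g z h))" for h
      using exp_not_eq_zero[of "l * g z h"]
      unfolding distrib_left right_diff_distrib exp_add exp_diff cosh_field_def exp_minus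
      by (simp add: field_simps)
    then have "(\<Sum>h\<in>H. exp (l * (A h + g z h))) + (\<Sum>h\<in>H. exp (l * (A h - g z h)))
        = 2 * (\<Sum>h\<in>H. exp (l * A h) * cosh (l * g z h))"
      by (simp only: sum.distrib[symmetric] sum_distrib_left)
    then show ?thesis by (simp only: distrib_right[symmetric])
  qed
  also have "\<dots> \<le> (\<Sum>h\<in>H. exp (l * A h) * ?c) * ?c ^ length zs"
  proof (intro mult_right_mono sum_mono mult_left_mono)
    fix h assume "h \<in> H"
    then have "\<bar>g z h\<bar> \<le> 1" using Cons by auto
    then have "(l * g z h)\<^sup>2 \<le> l\<^sup>2"
      by (simp add: power_mult_distrib mult_left_le abs_square_le_1)
    then show "cosh (l * g z h) \<le> ?c"
      using cosh_le_exp_half_square[of "l * g z h"] by (smt (verit) divide_right_mono exp_le_cancel_iff)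
  qed auto
  finally show ?case by (simp add: sum_distrib_right[symmetric] mult.assoc)
qed

text \<open>Massart's finite class lemma. Working with a positive bound \<open>b\<close> on the
  log-cardinality keeps \<open>l\<close> positive even when \<open>H\<close> is a singleton.\<close>

lemma rad_finite_class_le:
  fixes b :: real
  assumes H: "finite H" "H \<noteq> {}"
    and g: "\<And>z h. z \<in> set zs \<Longrightarrow> h \<in> H \<Longrightarrow> \<bar>g z h\<bar> \<le> 1"
    and b: "ln (card H) \<le> b" "b > 0" and zs: "zs \<noteq> []"
  shows "rad H (map g zs) (\<lambda>_. 0) \<le> 2 * sqrt (b * length zs)"
proof -
  define n where "n = real (length zs)"
  have n: "n > 0" using zs by (simp add: n_def)
  \<comment> \<open>Makes \<open>l\<^sup>2 * n\<close> equal to \<open>b\<close>, so both terms of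
    the exponent are of order \<open>b\<close>.\<close>
  define l where "l = sqrt (b / n)"
  have l: "l > 0" using b n by (simp add: l_def)
  let ?r = "rad H (map g zs) (\<lambda>_. 0)"
  have cH: "card H > 0" using H by (simp add: card_gt_0_iff)
  have "exp (l * ?r) \<le> card H * exp (l\<^sup>2 / 2) ^ length zs"
    using exp_rad_le[of H zs g l "\<lambda>_. 0"] H g by simp
  also have "\<dots> = exp (ln (card H) + l\<^sup>2 / 2 * n)"
    using cH by (simp add: exp_add n_def exp_of_nat_mult[symmetric] mult.commute)
  finally have "l * ?r \<le> ln (card H) + l\<^sup>2 / 2 * n" by simp
  also have "\<dots> \<le> b + l\<^sup>2 / 2 * n" using b by simp
  also have "\<dots> \<le> 2 * b" using b n by (simp add: l_def)
  also have "\<dots> = l * (2 * sqrt (b * n))"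
    using b n by (simp add: l_def real_sqrt_mult real_sqrt_divide)
  finally show ?thesis using l by (simp add: n_def)
qed

section \<open>Symmetrization\<close>

lemma expectation_finite_pmf:
  fixes f :: "'a \<Rightarrow> real"
  assumes "finite (set_pmf D)"
  shows "measure_pmf.expectation D f = (\<Sum>z\<in>set_pmf D. pmf D z * f z)"
  using integral_measure_pmf_real[OF assms, of D f] by (simp add: mult.commute)

lemma sum_pmf_set_pmf: "finite (set_pmf D) \<Longrightarrow> (\<Sum>z\<in>set_pmf D. pmf D z) = 1"
  by (rule sum_pmf_eq_1) auto

lemma expectation_mono_finite_pmf:
  fixes f g :: "'a \<Rightarrow> real"
  assumes "finite (set_pmf D)" "\<And>z. z \<in> set_pmf D \<Longrightarrow> f z \<le> g z"
  shows "measure_pmf.expectation D f \<le> measure_pmf.expectation D g"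
  unfolding expectation_finite_pmf[OF assms(1)] using assms(2)
  by (intro sum_mono mult_left_mono) auto

lemma expectation_le_const_finite_pmf:
  fixes f :: "'a \<Rightarrow> real"
  assumes "finite (set_pmf D)" "\<And>z. z \<in> set_pmf D \<Longrightarrow> f z \<le> B"
  shows "measure_pmf.expectation D f \<le> B"
  using expectation_mono_finite_pmf[of D f "\<lambda>_. B"] assms by simp

lemma expectation_bind_finite_pmf:
  fixes g :: "'b \<Rightarrow> real"
  assumes P: "finite (set_pmf P)" and f: "\<And>x. x \<in> set_pmf P \<Longrightarrow> finite (set_pmf (f x))"
  shows "measure_pmf.expectation (bind_pmf P f) g
    = measure_pmf.expectation P (\<lambda>x. measure_pmf.expectation (f x) g)"
proof -
  define B where "B = set_pmf (bind_pmf P f)"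
  have B: "finite B" using P f by (auto simp: B_def)
  have "measure_pmf.expectation (bind_pmf P f) g = (\<Sum>b\<in>B. g b * pmf (bind_pmf P f) b)"
    using B by (intro integral_measure_pmf_real) (auto simp: B_def)
  also have "\<dots> = (\<Sum>b\<in>B. \<Sum>a\<in>set_pmf P. pmf P a * (g b * pmf (f a) b))"
    by (simp add: pmf_bind expectation_finite_pmf[OF P] sum_distrib_left mult.left_commute)
  also have "\<dots> = (\<Sum>a\<in>set_pmf P. pmf P a * (\<Sum>b\<in>B. g b * pmf (f a) b))"
    by (subst sum.swap) (simp add: sum_distrib_left)
  also have "\<dots> = (\<Sum>a\<in>set_pmf P. pmf P a * measure_pmf.expectation (f a) g)"
  proof (intro sum.cong refl)
    fix a assume "a \<in> set_pmf P"
    then have "measure_pmf.expectation (f a) g = (\<Sum>b\<in>B. g b * pmf (f a) b)"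
      using B by (intro integral_measure_pmf_real) (auto simp: B_def)
    then show "pmf P a * (\<Sum>b\<in>B. g b * pmf (f a) b) = pmf P a * measure_pmf.expectation (f a) g"
      by simp
  qed
  finally show ?thesis by (simp add: expectation_finite_pmf[OF P])
qed

lemma finite_set_replicate_pmf:
  assumes "finite (set_pmf D)"
  shows "finite (set_pmf (replicate_pmf n D))"
proof -
  have "set_pmf (replicate_pmf n D) = {xs. set xs \<subseteq> set_pmf D \<and> length xs = n}"
    by (auto simp: set_replicate_pmf lists_eq_set)
  then show ?thesis using finite_lists_length_eq[OF assms] by simp
qed

lemma expectation_replicate_pmf_Suc:
  fixes f :: "'a list \<Rightarrow> real"
  assumes "finite (set_pmf D)"
  shows "measure_pmf.expectation (replicate_pmf (Suc n) D) f
    = measure_pmf.expectation D (\<lambda>z. measure_pmf.expectation (replicate_pmf n D) (\<lambda>S. f (z # S)))"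
  using assms finite_set_replicate_pmf[OF assms, of n]
  by (simp add: expectation_bind_finite_pmf)

lemma expectation_pair_finite_pmf:
  fixes f :: "'a \<times> 'b \<Rightarrow> real"
  assumes "finite (set_pmf D)" "finite (set_pmf D')"
  shows "measure_pmf.expectation (pair_pmf D D') f
    = measure_pmf.expectation D (\<lambda>z. measure_pmf.expectation D' (\<lambda>z'. f (z, z')))"
  using assms by (simp add: pair_pmf_def expectation_bind_finite_pmf)

lemma expectation_swap_finite_pmf:
  fixes f :: "'a \<Rightarrow> 'b \<Rightarrow> real"
  assumes "finite (set_pmf D)" "finite (set_pmf D')"
  shows "measure_pmf.expectation D (\<lambda>z. measure_pmf.expectation D' (f z))
    = measure_pmf.expectation D' (\<lambda>z'. measure_pmf.expectation D (\<lambda>z. f z z'))"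
  using assms
  by (simp add: expectation_finite_pmf sum_distrib_left) (subst sum.swap, simp add: mult.left_commute)

text \<open>Jensen's inequality for the convex functional \<open>rad\<close>: the weights
  \<open>pmf D z\<close> sum to one, so averaging the fixed functions \<open>gs\<close> gives them
  back.\<close>

lemma rad_expectation_le:
  assumes H: "finite H" "H \<noteq> {}" and D: "finite (set_pmf D)"
  shows "rad H gs (\<lambda>h. measure_pmf.expectation D (\<lambda>z. A z h))
    \<le> measure_pmf.expectation D (\<lambda>z. rad H gs (A z))"
  using rad_weighted_sum_le[OF H, of "set_pmf D" "pmf D" "\<lambda>_ g. g" gs A]
  by (simp add: expectation_finite_pmf[OF D] sum_distrib_right[symmetric] sum_pmf_set_pmf[OF D])

text \<open>Ghost samples are introduced one at a time, by induction on \<open>n\<close>. The term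
  of a treated example is absorbed into the offset \<open>A\<close>, which is why \<open>A\<close>
  is arbitrary.\<close>

lemma symmetrization:
  fixes D :: "'z pmf" and l :: "'z \<Rightarrow> 'h \<Rightarrow> real"
  assumes H: "finite H" "H \<noteq> {}" and D: "finite (set_pmf D)"
  defines "L \<equiv> \<lambda>h. measure_pmf.expectation D (\<lambda>z. l z h)"
  shows "measure_pmf.expectation (replicate_pmf n D)
      (\<lambda>S. Max ((\<lambda>h. A h + (\<Sum>z\<leftarrow>S. L h - l z h)) ` H))
    \<le> measure_pmf.expectation (replicate_pmf n (pair_pmf D D))
      (\<lambda>ps. rad H (map (\<lambda>(z, z') h. l z' h - l z h) ps) A)"
proof (induction n arbitrary: A)
  case (Suc n)
  let ?E = "measure_pmf.expectation"
  let ?rp = "replicate_pmf n (pair_pmf D D)"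
  define \<delta> where "\<delta> = (\<lambda>(z, z') h. l z' h - l z h)"
  define R where "R B = ?E ?rp (\<lambda>ps. rad H (map \<delta> ps) B)" for B
  have P: "finite (set_pmf (pair_pmf D D))" using D by simp
  have rp: "finite (set_pmf ?rp)" by (rule finite_set_replicate_pmf[OF P])
  have jensen: "R (\<lambda>h. ?E D (\<lambda>z'. B z' h)) \<le> ?E D (\<lambda>z'. R (B z'))" for B
  proof -
    have "R (\<lambda>h. ?E D (\<lambda>z'. B z' h)) \<le> ?E ?rp (\<lambda>ps. ?E D (\<lambda>z'. rad H (map \<delta> ps) (B z')))"
      unfolding R_def using rp by (intro expectation_mono_finite_pmf rad_expectation_le H D) auto
    also have "\<dots> = ?E D (\<lambda>z'. R (B z'))"
      unfolding R_def by (rule expectation_swap_finite_pmf[OF rp D])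
    finally show ?thesis .
  qed
  have "?E (replicate_pmf (Suc n) D) (\<lambda>S. Max ((\<lambda>h. A h + (\<Sum>z\<leftarrow>S. L h - l z h)) ` H))
      = ?E D (\<lambda>z. ?E (replicate_pmf n D)
          (\<lambda>S. Max ((\<lambda>h. (A h + (L h - l z h)) + (\<Sum>z\<leftarrow>S. L h - l z h)) ` H)))"
    by (simp only: expectation_replicate_pmf_Suc[OF D] list.map sum_list.Cons add.assoc)
  also have "\<dots> \<le> ?E D (\<lambda>z. R (\<lambda>h. A h + (L h - l z h)))"
    unfolding R_def \<delta>_def by (intro expectation_mono_finite_pmf D Suc)
  \<comment> \<open>The true risk \<open>L h\<close> is written as the mean over a ghost example
    \<open>z'\<close>, so that Jensen's inequality can move that mean outside.\<close>
  also have "\<dots> = ?E D (\<lambda>z. R (\<lambda>h. ?E D (\<lambda>z'. A h + (l z' h - l z h))))"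
    using D by (simp add: L_def integrable_measure_pmf_finite)
  also have "\<dots> \<le> ?E D (\<lambda>z. ?E D (\<lambda>z'. R (\<lambda>h. A h + (l z' h - l z h))))"
    by (intro expectation_mono_finite_pmf D jensen)
  finally have *: "?E (replicate_pmf (Suc n) D) (\<lambda>S. Max ((\<lambda>h. A h + (\<Sum>z\<leftarrow>S. L h - l z h)) ` H))
      \<le> ?E D (\<lambda>z. ?E D (\<lambda>z'. R (\<lambda>h. A h + (l z' h - l z h))))" (is "_ \<le> ?T") .
  \<comment> \<open>The example and its ghost are exchangeable, so both values of the sign give the
    same expectation, and this common value is the average that \<open>rad\<close> takes.\<close>
  have sw: "?E D (\<lambda>z. ?E D (\<lambda>z'. R (\<lambda>h. A h - (l z' h - l z h)))) = ?T"
    by (subst expectation_swap_finite_pmf[OF D D]) (simp add: algebra_simps)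
  have "?E (replicate_pmf (Suc n) (pair_pmf D D)) (\<lambda>ps. rad H (map \<delta> ps) A)
      = ?E D (\<lambda>z. ?E D (\<lambda>z'. (R (\<lambda>h. A h + (l z' h - l z h)) + R (\<lambda>h. A h - (l z' h - l z h))) / 2))"
    unfolding expectation_replicate_pmf_Suc[OF P] expectation_pair_finite_pmf[OF D D]
    using rp by (simp add: R_def integrable_measure_pmf_finite) (simp add: \<delta>_def)
  also have "\<dots> = (?T + ?E D (\<lambda>z. ?E D (\<lambda>z'. R (\<lambda>h. A h - (l z' h - l z h))))) / 2"
    using D by (simp add: integrable_measure_pmf_finite)
  finally show ?case using * sw by (simp add: \<delta>_def)
qed simp

section \<open>Exponential mechanism and randomized response\<close>

definition exp_mech :: "'h set \<Rightarrow> real \<Rightarrow> ('h \<Rightarrow> real) \<Rightarrow> 'h pmf" where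
  "exp_mech H t q = embed_pmf (\<lambda>h. if h \<in> H then exp (- t * q h) / (\<Sum>h'\<in>H. exp (- t * q h')) else 0)"

context
  fixes H :: "'h set"
  assumes H: "finite H" "H \<noteq> {}"
begin

lemma pmf_exp_mech:
  "pmf (exp_mech H t q) h = (if h \<in> H then exp (- t * q h) / (\<Sum>h'\<in>H. exp (- t * q h')) else 0)"
proof -
  let ?Z = "\<Sum>h'\<in>H. exp (- t * q h')"
  have Z: "?Z > 0" using H by (intro sum_pos) auto
  show ?thesis unfolding exp_mech_def
  proof (rule pmf_embed_pmf)
    have "(\<integral>\<^sup>+h. ennreal (if h \<in> H then exp (- t * q h) / ?Z else 0) \<partial>count_space UNIV)
        = (\<Sum>h\<in>H. ennreal (exp (- t * q h) / ?Z))"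
      using H Z by (subst nn_integral_count_space'[of H]) auto
    also have "\<dots> = ennreal (\<Sum>h\<in>H. exp (- t * q h) / ?Z)" using Z by (intro sum_ennreal) auto
    also have "(\<Sum>h\<in>H. exp (- t * q h) / ?Z) = 1" using Z by (simp add: sum_divide_distrib[symmetric])
    finally show "(\<integral>\<^sup>+h. ennreal (if h \<in> H then exp (- t * q h) / ?Z else 0) \<partial>count_space UNIV) = 1"
      by simp
  qed (use Z in auto)
qed

lemma set_pmf_exp_mech: "set_pmf (exp_mech H t q) = H"
proof -
  have Z: "(\<Sum>h'\<in>H. exp (- t * q h')) > 0" using H by (intro sum_pos) auto
  show ?thesis using Z by (auto simp: set_pmf_eq pmf_exp_mech)
qed

text \<open>One factor \<open>exp (t * c)\<close> comes from the numerator, the other from the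
  normalising sum.\<close>

lemma exp_mech_ratio:
  assumes t: "t \<ge> 0" and q: "\<And>h. h \<in> H \<Longrightarrow> \<bar>q h - q' h\<bar> \<le> c"
  shows "pmf (exp_mech H t q) h \<le> exp (2 * t * c) * pmf (exp_mech H t q') h"
proof (cases "h \<in> H")
  case True
  let ?Z = "\<Sum>h'\<in>H. exp (- t * q h')" and ?Z' = "\<Sum>h'\<in>H. exp (- t * q' h')"
  have Z: "?Z > 0" "?Z' > 0" using H by (auto intro!: sum_pos)
  have e: "exp (- t * u) \<le> exp (t * c) * exp (- t * v)" if "v - u \<le> c" for u v
    using mult_left_mono[OF that t] by (simp add: exp_add[symmetric] algebra_simps)
  have "?Z' \<le> (\<Sum>h'\<in>H. exp (t * c) * exp (- t * q h'))"
    using q by (intro sum_mono e) (smt (verit))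
  then have 1: "?Z' \<le> exp (t * c) * ?Z" by (simp add: sum_distrib_left)
  have 2: "exp (- t * q h) \<le> exp (t * c) * exp (- t * q' h)" using q[OF True] by (intro e) auto
  have "exp (- t * q h) * ?Z' \<le> (exp (t * c) * exp (- t * q' h)) * (exp (t * c) * ?Z)"
    using 1 2 Z by (intro mult_mono) auto
  also have "\<dots> = exp (2 * t * c) * exp (- t * q' h) * ?Z"
    by (simp add: exp_add[symmetric] algebra_simps)
  finally show ?thesis using True Z by (simp add: pmf_exp_mech field_simps)
qed (simp add: pmf_exp_mech)

text \<open>The Gibbs distribution minimises expected score minus entropy over \<open>t\<close>, and the entropy is at
  most \<open>ln (card H)\<close>.\<close>
lemma exp_mech_utility:
  assumes t: "t > 0" and h0: "h0 \<in> H"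
  shows "measure_pmf.expectation (exp_mech H t q) q \<le> q h0 + ln (card H) / t"
proof -
  let ?p = "pmf (exp_mech H t q)"
  define Z where "Z = (\<Sum>h'\<in>H. exp (- t * q h'))"
  define N where "N = real (card H)"
  have N: "N > 0" using H by (simp add: N_def card_gt_0_iff)
  have Z: "Z > 0" unfolding Z_def using H by (intro sum_pos) auto
  have p: "?p h = exp (- t * q h) / Z" if "h \<in> H" for h using that by (simp add: pmf_exp_mech Z_def)
  have p1: "(\<Sum>h\<in>H. ?p h) = 1" using H by (intro sum_pmf_eq_1) (auto simp: set_pmf_exp_mech)
  have E: "measure_pmf.expectation (exp_mech H t q) q = (\<Sum>h\<in>H. q h * ?p h)"
    using H by (intro integral_measure_pmf_real) (auto simp: set_pmf_exp_mech)
  \<comment> \<open>Gibbs' inequality against the uniform distribution: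
    \<open>t * q h + ln Z\<close> is \<open>- ln (?p h)\<close>, and \<open>ln u \<le> u - 1\<close>
    is applied at \<open>u = 1 / (N * ?p h)\<close>.\<close>
  have "(\<Sum>h\<in>H. ?p h * (t * q h + ln Z - ln N)) \<le> (\<Sum>h\<in>H. 1 / N - ?p h)"
  proof (rule sum_mono)
    fix h assume h: "h \<in> H"
    have pp: "?p h > 0" using Z by (simp add: p[OF h])
    have "t * q h + ln Z - ln N = ln (1 / (N * ?p h))"
      using Z N by (simp add: p[OF h] ln_div ln_mult)
    also have "\<dots> \<le> 1 / (N * ?p h) - 1" using N pp by (intro ln_le_minus_one) auto
    finally have "?p h * (t * q h + ln Z - ln N) \<le> ?p h * (1 / (N * ?p h) - 1)"
      using pp by (intro mult_left_mono) auto
    also have "\<dots> = 1 / N - ?p h" using pp by (simp add: field_simps)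
    finally show "?p h * (t * q h + ln Z - ln N) \<le> 1 / N - ?p h" .
  qed
  also have "\<dots> = 0" using N by (simp add: sum_subtractf p1 N_def)
  also have "(\<Sum>h\<in>H. ?p h * (t * q h + ln Z - ln N)) = t * (\<Sum>h\<in>H. q h * ?p h) + (ln Z - ln N) * (\<Sum>h\<in>H. ?p h)"
    by (simp add: sum_distrib_left sum.distrib[symmetric] algebra_simps)
  finally have 1: "t * (\<Sum>h\<in>H. q h * ?p h) \<le> ln N - ln Z" using p1 by simp
  have "exp (- t * q h0) \<le> Z" unfolding Z_def using H h0 by (intro member_le_sum) auto
  then have "- t * q h0 \<le> ln Z" using Z by (simp add: ln_ge_iff)
  with 1 have "t * (\<Sum>h\<in>H. q h * ?p h) \<le> t * q h0 + ln N" by simp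
  then have "(\<Sum>h\<in>H. q h * ?p h) \<le> (t * q h0 + ln N) / t" using t by (simp add: field_simps)
  then show ?thesis using t by (simp add: E N_def add_divide_distrib)
qed

end

section \<open>Randomized response on the labels\<close>

definition rr :: "real \<Rightarrow> int \<Rightarrow> int pmf" where
  "rr \<epsilon> y = map_pmf (\<lambda>b. if b then y else - y) (bernoulli_pmf (exp \<epsilon> / (1 + exp \<epsilon>)))"

lemma exp_frac_bounds: "0 \<le> exp \<epsilon> / (1 + exp \<epsilon>)" "exp \<epsilon> / (1 + exp \<epsilon>) \<le> (1::real)"
  by (auto simp: add_pos_pos divide_le_eq_1)

lemma expectation_rr:
  fixes f :: "int \<Rightarrow> real"
  shows "measure_pmf.expectation (rr \<epsilon> y) f = (exp \<epsilon> * f y + f (- y)) / (1 + exp \<epsilon>)"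
proof -
  have "1 - exp \<epsilon> / (1 + exp \<epsilon>) = 1 / (1 + exp \<epsilon>)"
  proof -
    have "1 + exp \<epsilon> \<noteq> 0" using exp_gt_zero[of \<epsilon>] by linarith
    then show ?thesis by (simp add: field_simps)
  qed
  then show ?thesis using exp_frac_bounds[of \<epsilon>] by (simp add: rr_def add_divide_distrib)
qed

lemma set_pmf_rr: "set_pmf (rr \<epsilon> y) \<subseteq> {y, - y}"
  by (auto simp: rr_def)

text \<open>The two weights form a row of the inverse of the channel matrix of \<open>rr\<close>.
  Hence any function of the true label has an unbiased estimate computed from the noisy
  label.\<close>

lemma rr_debias:
  fixes u :: "int \<Rightarrow> real"
  assumes "\<epsilon> > 0"
  shows "measure_pmf.expectation (rr \<epsilon> y) (\<lambda>z. exp \<epsilon> / (exp \<epsilon> - 1) * u z - 1 / (exp \<epsilon> - 1) * u (- z)) = u y"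
proof -
  define e where "e = exp \<epsilon>"
  define r where "r = 1 / (e - 1)"
  have e: "e > 1" using assms by (simp add: e_def)
  have r: "r * (e - 1) = 1" "e / (e - 1) = e * r" using e by (simp_all add: r_def)
  have "e * (e * r * u y - r * u (- y)) + (e * r * u (- y) - r * u y) = (r * (e - 1)) * ((1 + e) * u y)"
    by (simp add: algebra_simps)
  then have "(e * (e * r * u y - r * u (- y)) + (e * r * u (- y) - r * u y)) / (1 + e) = u y"
    using r e by simp
  then show ?thesis using r by (simp add: expectation_rr e_def[symmetric] r_def[symmetric])
qed

lemma rr_ratio:
  assumes "\<epsilon> \<ge> 0" "y \<in> {-1, 1}" "y' \<in> {-1, 1}"
  shows "pmf (rr \<epsilon> y') z \<le> exp \<epsilon> * pmf (rr \<epsilon> y) z"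
proof -
  have pmf: "pmf (rr \<epsilon> y) z = (exp \<epsilon> * indicator {z} y + indicator {z} (- y)) / (1 + exp \<epsilon>)" for y
  proof -
    have "pmf (rr \<epsilon> y) z = measure_pmf.expectation (rr \<epsilon> y) (indicator {z})"
      by (simp add: measure_pmf_single)
    then show ?thesis by (simp only: expectation_rr)
  qed
  have e: "exp \<epsilon> \<ge> 1" using assms(1) by auto
  then have "exp \<epsilon> * 1 \<le> exp \<epsilon> * exp \<epsilon>" by (intro mult_left_mono) auto
  with e have e: "exp \<epsilon> \<ge> 1" "exp \<epsilon> \<le> exp \<epsilon> * exp \<epsilon>" "1 \<le> exp \<epsilon> * exp \<epsilon>" by linarith+
  have "exp \<epsilon> * indicator {z} y' + indicator {z} (- y')
      \<le> exp \<epsilon> * (exp \<epsilon> * indicator {z} y + indicator {z} (- y))"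
    using assms(2,3) e by (auto simp: indicator_def distrib_left)
  then have "(exp \<epsilon> * indicator {z} y' + indicator {z} (- y')) / (1 + exp \<epsilon>)
      \<le> exp \<epsilon> * (exp \<epsilon> * indicator {z} y + indicator {z} (- y)) / (1 + exp \<epsilon>)"
    by (intro divide_right_mono) (auto simp: add_nonneg_nonneg)
  then show ?thesis by (simp add: pmf)
qed

fun rr_list :: "real \<Rightarrow> int list \<Rightarrow> int list pmf" where
  "rr_list \<epsilon> [] = return_pmf []"
| "rr_list \<epsilon> (y # ys) = map_pmf (\<lambda>(z, zs). z # zs) (pair_pmf (rr \<epsilon> y) (rr_list \<epsilon> ys))"

lemma set_pmf_rr_list:
  "set ys \<subseteq> {-1, 1} \<Longrightarrow> zs \<in> set_pmf (rr_list \<epsilon> ys) \<Longrightarrow> length zs = length ys \<and> set zs \<subseteq> {-1, 1}"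
proof (induction ys arbitrary: zs)
  case (Cons y ys)
  then show ?case using set_pmf_rr[of \<epsilon> y] by fastforce
qed auto

lemma rr_list_ratio:
  assumes "\<epsilon> \<ge> 0" "set ys \<subseteq> {-1, 1}" "y' \<in> {-1, 1}" "i < length ys"
  shows "pmf (rr_list \<epsilon> (ys[i := y'])) zs \<le> exp \<epsilon> * pmf (rr_list \<epsilon> ys) zs"
  using assms(2,4)
proof (induction ys arbitrary: i zs)
  case (Cons y ys)
  have pn: "pmf (rr_list \<epsilon> (v # vs)) [] = 0" for v vs by (auto simp: pmf_eq_0_set_pmf)
  have inj: "inj (\<lambda>(z :: int, zs). z # zs)" by (auto simp: inj_def)
  have pc: "pmf (rr_list \<epsilon> (v # vs)) (w # ws) = pmf (rr \<epsilon> v) w * pmf (rr_list \<epsilon> vs) ws" for v vs w ws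
    using pmf_map_inj'[OF inj, of "pair_pmf (rr \<epsilon> v) (rr_list \<epsilon> vs)" "(w, ws)"] by (simp add: pmf_pair)
  show ?case
  proof (cases zs)
    case Nil
    then show ?thesis using pn by (cases i) (auto simp del: rr_list.simps)
  next
    case zs: (Cons w ws)
    show ?thesis
    proof (cases i)
      case 0
      have "pmf (rr \<epsilon> y') w * pmf (rr_list \<epsilon> ys) ws \<le> exp \<epsilon> * pmf (rr \<epsilon> y) w * pmf (rr_list \<epsilon> ys) ws"
        using Cons.prems assms by (intro mult_right_mono rr_ratio) auto
      then show ?thesis using 0 zs by (simp add: pc mult.assoc del: rr_list.simps)
    next
      case (Suc j)
      have "pmf (rr_list \<epsilon> (ys[j := y'])) ws \<le> exp \<epsilon> * pmf (rr_list \<epsilon> ys) ws"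
        using Cons Suc by auto
      then have "pmf (rr \<epsilon> y) w * pmf (rr_list \<epsilon> (ys[j := y'])) ws
          \<le> pmf (rr \<epsilon> y) w * (exp \<epsilon> * pmf (rr_list \<epsilon> ys) ws)"
        by (intro mult_left_mono) auto
      then show ?thesis using Suc zs by (simp add: pc mult.left_commute del: rr_list.simps)
    qed
  qed
qed simp

definition noisy :: "real \<Rightarrow> ('x \<times> int) pmf \<Rightarrow> ('x \<times> int) pmf" where
  "noisy \<epsilon> D = bind_pmf D (\<lambda>(x, y). map_pmf (Pair x) (rr \<epsilon> y))"

text \<open>Since labels are perturbed independently, privatising an i.i.d. sample yields an i.i.d.
  sample from \<open>noisy \<epsilon> D\<close>, to which symmetrization applies.\<close>

lemma replicate_noisy:
  "bind_pmf (replicate_pmf n D) (\<lambda>S. map_pmf (zip (map fst S)) (rr_list \<epsilon> (map snd S)))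
    = replicate_pmf n (noisy \<epsilon> D)"
proof (induction n)
  case (Suc n)
  have "bind_pmf (replicate_pmf (Suc n) D) (\<lambda>S. map_pmf (zip (map fst S)) (rr_list \<epsilon> (map snd S)))
    = bind_pmf D (\<lambda>r. bind_pmf (replicate_pmf n D) (\<lambda>S. bind_pmf (rr \<epsilon> (snd r))
        (\<lambda>z. bind_pmf (rr_list \<epsilon> (map snd S)) (\<lambda>zs. return_pmf ((fst r, z) # zip (map fst S) zs)))))"
    by (simp add: bind_assoc_pmf bind_return_pmf map_pmf_def pair_pmf_def)
  also have "\<dots> = bind_pmf D (\<lambda>r. bind_pmf (rr \<epsilon> (snd r)) (\<lambda>z. bind_pmf (replicate_pmf n D)
        (\<lambda>S. bind_pmf (rr_list \<epsilon> (map snd S)) (\<lambda>zs. return_pmf ((fst r, z) # zip (map fst S) zs)))))"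
    by (subst (2) bind_commute_pmf) simp
  also have "\<dots> = replicate_pmf (Suc n) (noisy \<epsilon> D)"
  proof -
    have "replicate_pmf (Suc n) (noisy \<epsilon> D) = bind_pmf (noisy \<epsilon> D) (\<lambda>z. bind_pmf
        (bind_pmf (replicate_pmf n D) (\<lambda>S. map_pmf (zip (map fst S)) (rr_list \<epsilon> (map snd S))))
        (\<lambda>zs. return_pmf (z # zs)))"
      by (simp only: Suc replicate_pmf.simps)
    then show ?thesis
      by (simp add: noisy_def bind_assoc_pmf bind_return_pmf map_pmf_def case_prod_unfold)
  qed
  finally show ?case .
qed (simp add: bind_return_pmf)

section \<open>Learning a projected class\<close>

text \<open>It vanishes up to 1/3 and equals 1 from 2/3 on. These are the thresholds between which
  the sampled score separates robust from non-robust examples; the slope 3 is the price of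
  contraction.\<close>

definition ramp :: "real \<Rightarrow> real" where
  "ramp t = max 0 (min 1 (3 * t - 1))"

lemma ramp_lipschitz: "\<bar>ramp a - ramp b\<bar> \<le> \<bar>3 * a - 3 * b\<bar>"
  by (auto simp: ramp_def)

lemma ramp_bounds: "0 \<le> ramp t" "ramp t \<le> 1"
  by (auto simp: ramp_def)

lemma sum_list_list_update_diff:
  fixes f :: "'a \<Rightarrow> real"
  shows "i < length T \<Longrightarrow> (\<Sum>z\<leftarrow>T[i := r]. f z) - (\<Sum>z\<leftarrow>T. f z) = f r - f (T ! i)"
  by (induction T arbitrary: i) (auto split: nat.splits)

lemma measure_bind_finite_pmf:
  assumes "finite (set_pmf P)" "\<And>x. x \<in> set_pmf P \<Longrightarrow> finite (set_pmf (f x))"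
  shows "measure_pmf.prob (bind_pmf P f) E
    = measure_pmf.expectation P (\<lambda>x. measure_pmf.prob (f x) E)"
  using expectation_bind_finite_pmf[of P f "indicator E", OF assms] by simp

lemma expectation_sum_list_replicate_pmf:
  fixes f :: "'a \<Rightarrow> real"
  assumes D: "finite (set_pmf D)"
  shows "measure_pmf.expectation (replicate_pmf n D) (\<lambda>S. \<Sum>z\<leftarrow>S. f z)
    = n * measure_pmf.expectation D f"
proof (induction n)
  case (Suc n)
  then show ?case
    using D finite_set_replicate_pmf[OF D, of n]
    unfolding expectation_replicate_pmf_Suc[OF D]
    by (simp add: integrable_measure_pmf_finite algebra_simps)
qed simp

definition debias_pos :: "real \<Rightarrow> real" where "debias_pos \<epsilon> = exp \<epsilon> / (exp \<epsilon> - 1)"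
definition debias_neg :: "real \<Rightarrow> real" where "debias_neg \<epsilon> = 1 / (exp \<epsilon> - 1)"

lemma debias_bounds:
  assumes "0 < \<epsilon>" "\<epsilon> \<le> 1"
  shows "0 < debias_pos \<epsilon>" "0 < debias_neg \<epsilon>" "debias_pos \<epsilon> + debias_neg \<epsilon> \<le> 4 / \<epsilon>"
proof -
  have e: "exp \<epsilon> - 1 \<ge> \<epsilon>" using exp_ge_add_one_self[of \<epsilon>] by linarith
  have "exp \<epsilon> \<le> exp 1" using assms by simp
  also have "\<dots> \<le> 3" by (rule exp_le)
  finally have "exp \<epsilon> + 1 \<le> 4" by simp
  then have "(exp \<epsilon> + 1) / (exp \<epsilon> - 1) \<le> 4 / \<epsilon>" using e assms by (intro frac_le) auto
  then show "debias_pos \<epsilon> + debias_neg \<epsilon> \<le> 4 / \<epsilon>"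
    by (simp add: debias_pos_def debias_neg_def add_divide_distrib)
qed (use assms in \<open>auto simp: debias_pos_def debias_neg_def\<close>)

text \<open>The excess error is measured against each halfspace separately; the infimum is taken
  only in the final theorem.\<close>

definition learnable :: "real \<Rightarrow> real \<Rightarrow> real \<Rightarrow> nat \<Rightarrow> nat \<Rightarrow> real \<Rightarrow> bool" where
  "learnable \<epsilon> \<gamma> \<gamma>' d n B \<longleftrightarrow> (\<exists>M :: (int list \<times> int) list \<Rightarrow> (int list \<Rightarrow> int) pmf.
     (\<forall>S. length S = n \<and> set S \<subseteq> recdom d \<longrightarrow> set_pmf (M S) \<subseteq> halfspaces d) \<and>
     attr_dp \<epsilon> d n M \<and>
     (\<forall>D :: (int list \<times> int) pmf. set_pmf D \<subseteq> recdom d \<longrightarrow> (\<forall>h\<in>halfspaces d.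
        measure_pmf.expectation (bind_pmf (replicate_pmf n D) M) (\<lambda>h. robust_err d \<gamma>' h D)
        \<le> robust_err d \<gamma> h D + B)))"

lemma finite_recdom: "finite (cube d)" "finite (recdom d)"
proof -
  have "cube d = {x. set x \<subseteq> {-1, 1} \<and> length x = d}" by (auto simp: cube_def)
  then show "finite (cube d)" using finite_lists_length_eq[of "{-1, 1 :: int}" d] by simp
  then show "finite (recdom d)" by (simp add: recdom_def)
qed

text \<open>The score of a hypothesis is an average over random projections \<open>\<pi> i\<close> onto finite classes
  of log-size at most \<open>b\<close>; this is what makes the uniform deviation independent of \<open>card H\<close>. In the
  exponential mechanism, \<open>ln (card H)\<close> of order \<open>d\<close> is compensated by a sensitivity \<open>s\<close> of order \<open>1 / d\<close>.\<close>
locale projected_class =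
  fixes d :: nat and hyp :: "'h \<Rightarrow> int list \<Rightarrow> int" and H :: "'h set"
    and P :: "'i pmf" and f :: "'i \<Rightarrow> 'c \<Rightarrow> int list \<times> int \<Rightarrow> real" and \<pi> :: "'i \<Rightarrow> 'h \<Rightarrow> 'c"
    and s b :: real and g :: "'h \<Rightarrow> int list \<times> int \<Rightarrow> real"
  assumes H: "finite H" "H \<noteq> {}" and hyp: "\<And>h. h \<in> H \<Longrightarrow> hyp h \<in> halfspaces d"
    and P: "finite (set_pmf P)" and f: "\<And>i c z. \<bar>f i c z\<bar> \<le> 1"
    and g_def: "\<And>h z. g h z = measure_pmf.expectation P (\<lambda>i. f i (\<pi> i h) z)"
    and s: "s > 0" and b: "b > 0"
    and ln_proj: "\<And>i. i \<in> set_pmf P \<Longrightarrow> ln (card (\<pi> i ` H)) \<le> b"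
    and ln_H: "s * ln (card H) \<le> b"
    and sens: "\<And>h x x' y. h \<in> H \<Longrightarrow> x \<in> cube d \<Longrightarrow> x' \<in> cube d \<Longrightarrow> y \<in> {-1, 1} \<Longrightarrow>
      \<bar>g h (x, y) - g h (x', y)\<bar> \<le> s * hamming x x'"
begin

text \<open>The debiased ramp loss of a record with noisy label. By \<open>rr_debias\<close> its
  mean over the noise is the ramp of the score at the true label, although single values can be
  negative.\<close>

definition nloss :: "real \<Rightarrow> int list \<times> int \<Rightarrow> 'h \<Rightarrow> real" where
  "nloss \<epsilon> z h = debias_pos \<epsilon> * ramp (g h z) - debias_neg \<epsilon> * ramp (g h (fst z, - snd z))"

definition score :: "real \<Rightarrow> (int list \<times> int) list \<Rightarrow> 'h \<Rightarrow> real" where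
  "score \<epsilon> T h = (\<Sum>z\<leftarrow>T. nloss \<epsilon> z h)"

text \<open>Changing one coordinate moves the score by at most
  \<open>3 * s * (debias_pos \<epsilon> + debias_neg \<epsilon>)\<close>, and the exponential
  mechanism doubles this; the choice makes the total loss per coordinate exactly
  \<open>\<epsilon>\<close>.\<close>

definition temp :: "real \<Rightarrow> real" where
  "temp \<epsilon> = \<epsilon> / (6 * s * (debias_pos \<epsilon> + debias_neg \<epsilon>))"

definition learner :: "real \<Rightarrow> (int list \<times> int) list \<Rightarrow> (int list \<Rightarrow> int) pmf" where
  "learner \<epsilon> S = bind_pmf (rr_list \<epsilon> (map snd S))
     (\<lambda>ys. map_pmf hyp (exp_mech H (temp \<epsilon>) (score \<epsilon> (zip (map fst S) ys))))"

lemma learner_range: "set_pmf (learner \<epsilon> S) \<subseteq> halfspaces d"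
  using hyp by (auto simp: learner_def set_pmf_exp_mech[OF H])

lemma nloss_lipschitz:
  assumes "0 < \<epsilon>" "\<epsilon> \<le> 1" "h \<in> H" "x \<in> cube d" "x' \<in> cube d" "y \<in> {-1, 1}"
  shows "\<bar>nloss \<epsilon> (x, y) h - nloss \<epsilon> (x', y) h\<bar>
    \<le> 3 * s * (debias_pos \<epsilon> + debias_neg \<epsilon>) * hamming x x'"
proof -
  let ?a = "debias_pos \<epsilon>" and ?b = "debias_neg \<epsilon>" and ?c = "3 * (s * hamming x x')"
  note db = debias_bounds[OF assms(1,2)]
  have r: "\<bar>ramp (g h (x, y)) - ramp (g h (x', y))\<bar> \<le> ?c" if "y \<in> {-1, 1}" for y
    using ramp_lipschitz[of "g h (x, y)" "g h (x', y)"] sens[OF assms(3-5) that] by linarith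
  have "\<bar>nloss \<epsilon> (x, y) h - nloss \<epsilon> (x', y) h\<bar>
    = \<bar>?a * (ramp (g h (x, y)) - ramp (g h (x', y))) - ?b * (ramp (g h (x, - y)) - ramp (g h (x', - y)))\<bar>"
    by (simp add: nloss_def algebra_simps)
  also have "\<dots> \<le> ?a * \<bar>ramp (g h (x, y)) - ramp (g h (x', y))\<bar> + ?b * \<bar>ramp (g h (x, - y)) - ramp (g h (x', - y))\<bar>"
    using db by (intro order_trans[OF abs_triangle_ineq4]) (simp add: abs_mult)
  also have "\<dots> \<le> ?a * ?c + ?b * ?c"
    using db r[of y] r[of "- y"] assms(6) by (intro add_mono mult_left_mono) auto
  finally show ?thesis by (simp add: algebra_simps)
qed

lemma finite_rr_list: "finite (set_pmf (rr_list \<epsilon> ys))"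
  by (induction ys) (auto intro: finite_subset[OF set_pmf_rr])

lemma temp_pos: "0 < \<epsilon> \<Longrightarrow> \<epsilon> \<le> 1 \<Longrightarrow> temp \<epsilon> > 0"
  using debias_bounds[of \<epsilon>] s by (simp add: temp_def)

lemma exp_mech_prob_ratio:
  assumes "t \<ge> 0" "\<And>h. h \<in> H \<Longrightarrow> \<bar>q h - q' h\<bar> \<le> c"
  shows "measure_pmf.prob (map_pmf hyp (exp_mech H t q)) E
    \<le> exp (2 * t * c) * measure_pmf.prob (map_pmf hyp (exp_mech H t q')) E"
proof -
  have "measure_pmf.prob (map_pmf hyp (exp_mech H t q)) E
      = (\<Sum>h\<in>H. pmf (exp_mech H t q) h * indicator (hyp -` E) h)" for q
  proof -
    have "measure_pmf.prob (map_pmf hyp (exp_mech H t q)) E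
        = measure_pmf.expectation (exp_mech H t q) (indicator (hyp -` E))" by simp
    also have "\<dots> = (\<Sum>h\<in>H. pmf (exp_mech H t q) h * indicator (hyp -` E) h)"
      using expectation_finite_pmf[of "exp_mech H t q" "indicator (hyp -` E)"] H(1)
      unfolding set_pmf_exp_mech[OF H] by simp
    finally show ?thesis .
  qed
  moreover have "(\<Sum>h\<in>H. pmf (exp_mech H t q) h * indicator (hyp -` E) h)
    \<le> (\<Sum>h\<in>H. (exp (2 * t * c) * pmf (exp_mech H t q') h) * indicator (hyp -` E) h)"
    using exp_mech_ratio[OF H assms] by (intro sum_mono mult_right_mono) auto
  ultimately show ?thesis by (simp add: sum_distrib_left mult.assoc)
qed

text \<open>The two mechanisms protect different attributes: randomized response pays
  \<open>\<epsilon>\<close> for a change of the label, the exponential mechanism pays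
  \<open>\<epsilon>\<close> for each changed coordinate. The factors multiply to the bound for
  \<open>attr_dist\<close>.\<close>

lemma learner_attr_dp:
  assumes eps: "0 < \<epsilon>" "\<epsilon> \<le> 1"
  shows "attr_dp \<epsilon> d n (learner \<epsilon>)"
  unfolding attr_dp_def
proof (intro allI impI, elim conjE)
  fix S S' :: "(int list \<times> int) list" and i E
  assume len: "length S = n" "length S' = n" and dom: "set S \<subseteq> recdom d" "set S' \<subseteq> recdom d"
    and i: "i < n" and eq: "\<forall>j<n. j \<noteq> i \<longrightarrow> S ! j = S' ! j"
  define a where "a = real (hamming (fst (S ! i)) (fst (S' ! i)))"
  define l where "l = (if snd (S ! i) \<noteq> snd (S' ! i) then 1 else 0 :: real)"
  have upd: "S = S'[i := S ! i]" using len i eq by (auto intro!: nth_equalityI simp: nth_list_update)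
  have Si: "S ! i \<in> recdom d" "S' ! i \<in> recdom d" using len i dom by (auto intro: subsetD)
  then have Si': "fst (S ! i) \<in> cube d" "fst (S' ! i) \<in> cube d" "snd (S ! i) \<in> {-1, 1}" "snd (S' ! i) \<in> {-1, 1}"
    by (auto simp: recdom_def)
  have lab: "set (map snd S) \<subseteq> {-1, 1}" "set (map snd S') \<subseteq> {-1, 1}"
    using dom by (auto simp: recdom_def)
  let ?K = "\<lambda>S ys. map_pmf hyp (exp_mech H (temp \<epsilon>) (score \<epsilon> (zip (map fst S) ys)))"
  define A where "A = {ys :: int list. set ys \<subseteq> {-1, 1} \<and> length ys = n}"
  have A: "finite A" unfolding A_def by (rule finite_lists_length_eq) simp
  have prob: "measure_pmf.prob (learner \<epsilon> S) E = (\<Sum>ys\<in>A. measure_pmf.prob (?K S ys) E * pmf (rr_list \<epsilon> (map snd S)) ys)"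
    if "length S = n" "set (map snd S) \<subseteq> {-1, 1}" for S :: "(int list \<times> int) list"
    unfolding learner_def
  proof (subst measure_bind_finite_pmf)
    have "set_pmf (rr_list \<epsilon> (map snd S)) \<subseteq> A"
      using set_pmf_rr_list[OF that(2)] that(1) by (auto simp: A_def)
    then show "measure_pmf.expectation (rr_list \<epsilon> (map snd S)) (\<lambda>ys. measure_pmf.prob (?K S ys) E)
        = (\<Sum>ys\<in>A. measure_pmf.prob (?K S ys) E * pmf (rr_list \<epsilon> (map snd S)) ys)"
      by (intro integral_measure_pmf_real A) auto
  qed (use H in \<open>auto simp: finite_rr_list set_pmf_exp_mech[OF H]\<close>)
  \<comment> \<open>With the noisy labels \<open>ys\<close> fixed, the two inputs of the exponential
    mechanism differ only in the coordinates of record \<open>i\<close>.\<close>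
  have K: "measure_pmf.prob (?K S ys) E \<le> exp (\<epsilon> * a) * measure_pmf.prob (?K S' ys) E" if ys: "ys \<in> A" for ys
  proof -
    have ly: "length ys = n" "ys ! i \<in> {-1, 1}"
      using ys i nth_mem[of i ys] by (auto simp: A_def simp del: nth_mem)
    have z: "zip (map fst S) ys = (zip (map fst S') ys)[i := (fst (S ! i), ys ! i)]"
      using len i ly eq by (auto intro!: nth_equalityI simp: nth_list_update)
    have "\<bar>score \<epsilon> (zip (map fst S) ys) h - score \<epsilon> (zip (map fst S') ys) h\<bar>
        \<le> 3 * s * (debias_pos \<epsilon> + debias_neg \<epsilon>) * a" if "h \<in> H" for h
      unfolding z score_def using len ly i nloss_lipschitz[OF eps that Si'(1,2) ly(2)]
      by (subst sum_list_list_update_diff) (auto simp: a_def)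
    from exp_mech_prob_ratio[OF less_imp_le[OF temp_pos[OF eps]] this, where E = E]
    show ?thesis using s debias_bounds[OF eps] by (simp add: temp_def)
  qed
  have L: "pmf (rr_list \<epsilon> (map snd S)) ys \<le> exp (\<epsilon> * l) * pmf (rr_list \<epsilon> (map snd S')) ys" for ys
  proof (cases "snd (S ! i) = snd (S' ! i)")
    case True
    have "map snd S = map snd S'" 
    proof (rule nth_equalityI)
      fix j assume "j < length (map snd S)"
      then show "map snd S ! j = map snd S' ! j" using len eq True by (cases "j = i") auto
    qed (simp add: len)
    then show ?thesis using True by (simp add: l_def)
  next
    case False
    have "map snd S = (map snd S')[i := snd (S ! i)]" by (subst upd) (simp add: map_update)
    then show ?thesis
      using rr_list_ratio[of \<epsilon> "map snd S'" "snd (S ! i)" i ys] eps lab Si' len i False by (simp add: l_def)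
  qed
  have "measure_pmf.prob (learner \<epsilon> S) E \<le> (\<Sum>ys\<in>A. (exp (\<epsilon> * a) * measure_pmf.prob (?K S' ys) E)
      * (exp (\<epsilon> * l) * pmf (rr_list \<epsilon> (map snd S')) ys))"
    unfolding prob[OF len(1) lab(1)] using K L by (intro sum_mono mult_mono) auto
  also have "\<dots> = exp (\<epsilon> * (a + l)) * measure_pmf.prob (learner \<epsilon> S') E"
    unfolding prob[OF len(2) lab(2)] by (simp add: sum_distrib_left distrib_left exp_add mult_ac)
  also have "a + l = real (attr_dist (S ! i) (S' ! i))"
    by (simp add: a_def l_def attr_dist_def)
  finally show "measure_pmf.prob (learner \<epsilon> S) E \<le> exp (\<epsilon> * real (attr_dist (S ! i) (S' ! i))) * measure_pmf.prob (learner \<epsilon> S') E" .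
qed

text \<open>Contraction removes the ramp at the cost of a factor 3, convexity moves the average over
  projections outside, and every projected class has log-cardinality at most
  \<open>b\<close>.\<close>

lemma rad_ramp_le:
  assumes sgn: "c \<in> {-1, 1 :: real}" and zs: "zs \<noteq> []"
  shows "rad H (map (\<lambda>e h. c * ramp (g h (pt e))) zs) (\<lambda>_. 0) \<le> 6 * sqrt (b * length zs)"
proof -
  have "\<bar>c * ramp (g h (pt z)) - c * ramp (g h' (pt z))\<bar> = \<bar>ramp (g h (pt z)) - ramp (g h' (pt z))\<bar>" for h h' z
    using sgn by auto
  then have "rad H (map (\<lambda>e h. c * ramp (g h (pt e))) zs) (\<lambda>_. 0) \<le> rad H (map (\<lambda>e h. 3 * g h (pt e)) zs) (\<lambda>_. 0)"
    by (intro rad_contraction H) (simp add: ramp_lipschitz)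
  also have "\<dots> = rad H (map (\<lambda>e h. \<Sum>i\<in>set_pmf P. (3 * pmf P i) * f i (\<pi> i h) (pt e)) zs)
      (\<lambda>h. \<Sum>i\<in>set_pmf P. (3 * pmf P i) * 0)"
    by (simp add: g_def expectation_finite_pmf[OF P] sum_distrib_left mult.assoc)
  also have "\<dots> \<le> (\<Sum>i\<in>set_pmf P. (3 * pmf P i) * rad H (map (\<lambda>e h. f i (\<pi> i h) (pt e)) zs) (\<lambda>_. 0))"
    by (rule rad_weighted_sum_le[OF H, where A = "\<lambda>_ _. 0" and f = "\<lambda>i e h. f i (\<pi> i h) (pt e)"]) simp
  also have "\<dots> \<le> (\<Sum>i\<in>set_pmf P. (3 * pmf P i) * (2 * sqrt (b * length zs)))"
  proof (intro sum_mono mult_left_mono)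
    fix i assume i: "i \<in> set_pmf P"
    have "rad H (map (\<lambda>e h. f i (\<pi> i h) (pt e)) zs) (\<lambda>_. 0) = rad (\<pi> i ` H) (map (\<lambda>e c. f i c (pt e)) zs) (\<lambda>_. 0)"
      by (rule rad_reindex)
    also have "\<dots> \<le> 2 * sqrt (b * length zs)"
      by (rule rad_finite_class_le) (use H f ln_proj[OF i] b zs in auto)
    finally show "rad H (map (\<lambda>e h. f i (\<pi> i h) (pt e)) zs) (\<lambda>_. 0) \<le> 2 * sqrt (b * length zs)" .
  qed auto
  also have "\<dots> = (\<Sum>i\<in>set_pmf P. pmf P i) * (6 * sqrt (b * length zs))"
    unfolding sum_distrib_right by (intro sum.cong) auto
  finally show ?thesis by (simp add: sum_pmf_set_pmf[OF P])
qed

lemma rad_nloss_le: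
  assumes eps: "0 < \<epsilon>" "\<epsilon> \<le> 1" and ps: "ps \<noteq> []"
  shows "rad H (map (\<lambda>(z, z') h. nloss \<epsilon> z' h - nloss \<epsilon> z h) ps) (\<lambda>_. 0) \<le> 48 / \<epsilon> * sqrt (b * length ps)"
proof -
  let ?a = "debias_pos \<epsilon>" and ?b = "debias_neg \<epsilon>"
  note db = debias_bounds[OF eps]
  \<comment> \<open>The difference of two debiased losses has four ramp terms. The first bit of the
    index tells whether the label is kept or negated, the second whether \<open>z'\<close> or
    \<open>z\<close> is used. The weights sum to \<open>2 * (?a + ?b) \<le> 8 / \<epsilon>\<close>,
    which gives 6 * 8 = 48.\<close>
  define w where "w = (\<lambda>i :: bool \<times> bool. if fst i then ?a else ?b)"
  define c where "c = (\<lambda>i :: bool \<times> bool. if fst i = snd i then 1 else -1 :: real)"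
  define pt where "pt = (\<lambda>(i :: bool \<times> bool) (p :: (int list \<times> int) \<times> (int list \<times> int)).
    let z = (if snd i then snd p else fst p) in if fst i then z else (fst z, - snd z))"
  have UN: "(UNIV :: (bool \<times> bool) set) = {(True, True), (True, False), (False, True), (False, False)}" by auto
  have "(\<lambda>(z, z') h. nloss \<epsilon> z' h - nloss \<epsilon> z h) = (\<lambda>p h. \<Sum>i\<in>UNIV. w i * (c i * ramp (g h (pt i p))))"
    by (auto simp: fun_eq_iff UN nloss_def w_def c_def pt_def)
  then have "rad H (map (\<lambda>(z, z') h. nloss \<epsilon> z' h - nloss \<epsilon> z h) ps) (\<lambda>_. 0)
    = rad H (map (\<lambda>p h. \<Sum>i\<in>UNIV. w i * (c i * ramp (g h (pt i p)))) ps) (\<lambda>h. \<Sum>i\<in>UNIV. w i * 0)"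
    by simp
  also have "\<dots> \<le> (\<Sum>i\<in>UNIV. w i * rad H (map (\<lambda>p h. c i * ramp (g h (pt i p))) ps) (\<lambda>_. 0))"
    by (rule rad_weighted_sum_le[OF H, where A = "\<lambda>_ _. 0"  and f = "\<lambda>i p h. c i * ramp (g h (pt i p))"])
       (use db in \<open>auto simp: w_def\<close>)
  also have "\<dots> \<le> (\<Sum>i\<in>UNIV. w i * (6 * sqrt (b * length ps)))"
    by (intro sum_mono mult_left_mono rad_ramp_le ps) (use db in \<open>auto simp: w_def c_def\<close>)
  also have "\<dots> = 12 * (?a + ?b) * sqrt (b * length ps)"
    by (simp add: UN w_def algebra_simps)
  also have "\<dots> \<le> 12 * (4 / \<epsilon>) * sqrt (b * length ps)"
    using db b by (intro mult_right_mono mult_left_mono) auto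
  finally show ?thesis by simp
qed

text \<open>The robust error is at most the true ramp loss \<open>L\<close>, which is at most the
  empirical noisy score plus a uniform deviation. The exponential mechanism compares that score with
  the one of \<open>h0\<close>, whose mean is \<open>n * L h0\<close>.\<close>

lemma learner_utility:
  fixes \<gamma>' :: real
  assumes eps: "0 < \<epsilon>" "\<epsilon> \<le> 1" and n: "n \<ge> 1" and D: "set_pmf D \<subseteq> recdom d" and h0: "h0 \<in> H"
    and dominates: "\<And>h x y x'. h \<in> H \<Longrightarrow> (x, y) \<in> recdom d \<Longrightarrow> x' \<in> cube d \<Longrightarrow> hyp h x' \<noteq> y \<Longrightarrow>
      hamming x' x \<le> \<gamma>' * d \<Longrightarrow> g h (x, y) \<ge> 2 / 3"
  shows "measure_pmf.expectation (bind_pmf (replicate_pmf n D) (learner \<epsilon>)) (\<lambda>h. robust_err d \<gamma>' h D)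
    \<le> measure_pmf.expectation D (\<lambda>z. ramp (g h0 z)) + 48 * sqrt b / (\<epsilon> * sqrt n) + 24 * b / (\<epsilon>\<^sup>2 * n)"
proof -
  let ?E = "measure_pmf.expectation"
  define L where "L h = ?E D (\<lambda>z. ramp (g h z))" for h
  define N where "N = noisy \<epsilon> D"
  have finD: "finite (set_pmf D)" using D finite_recdom(2) finite_subset by blast
  have finrr: "finite (set_pmf (rr \<epsilon> y))" for y by (rule finite_subset[OF set_pmf_rr]) simp
  have finN: "finite (set_pmf N)" using finD finrr by (auto simp: N_def noisy_def)
  note finNn = finite_set_replicate_pmf[OF finN]
  \<comment> \<open>Unbiasedness: the clean ramp loss is the mean debiased loss under the noisy
    distribution.\<close>
  have LN: "L h = ?E N (\<lambda>z. nloss \<epsilon> z h)" for h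
  proof -
    have "?E N (\<lambda>z. nloss \<epsilon> z h) = ?E D (\<lambda>z. ?E (rr \<epsilon> (snd z)) (\<lambda>y. nloss \<epsilon> (fst z, y) h))"
      unfolding N_def noisy_def
      by (subst expectation_bind_finite_pmf) (use finD finrr in \<open>auto simp: case_prod_unfold\<close>)
    also have "\<dots> = L h"
    proof -
      have "?E (rr \<epsilon> (snd z)) (\<lambda>y. nloss \<epsilon> (fst z, y) h) = ramp (g h z)" for z
        using rr_debias[OF eps(1), of "snd z" "\<lambda>y. ramp (g h (fst z, y))"]
        by (simp add: nloss_def debias_pos_def debias_neg_def)
      then show ?thesis by (simp add: L_def)
    qed
    finally show ?thesis by simp
  qed
  have err: "robust_err d \<gamma>' (hyp h) D \<le> L h" if "h \<in> H" for h
  proof -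
    let ?A = "{(x, y). \<exists>x' \<in> cube d. hyp h x' \<noteq> y \<and> real (hamming x' x) \<le> \<gamma>' * real d}"
    have "robust_err d \<gamma>' (hyp h) D = ?E D (indicator ?A)" by (simp add: robust_err_def)
    also have "\<dots> \<le> L h" unfolding L_def
    proof (rule expectation_mono_finite_pmf[OF finD])
      fix z assume z: "z \<in> set_pmf D"
      show "indicator ?A z \<le> ramp (g h z)"
      proof (cases "z \<in> ?A")
        case True
        then obtain x y x' where "z = (x, y)" "x' \<in> cube d" "hyp h x' \<noteq> y" "real (hamming x' x) \<le> \<gamma>' * real d"
          by auto
        then have "g h z \<ge> 2 / 3" using dominates[OF that, of x y x'] z D by auto
        then show ?thesis by (auto simp: ramp_def indicator_def)
      qed (simp add: ramp_bounds)
    qed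
    finally show ?thesis .
  qed
  let ?X = "\<lambda>T. exp_mech H (temp \<epsilon>) (score \<epsilon> T)"
  have "bind_pmf (replicate_pmf n D) (learner \<epsilon>) = bind_pmf (replicate_pmf n N) (\<lambda>T. map_pmf hyp (?X T))"
    unfolding N_def replicate_noisy[symmetric] learner_def
    by (simp add: bind_assoc_pmf bind_map_pmf)
  then have "?E (bind_pmf (replicate_pmf n D) (learner \<epsilon>)) (\<lambda>h. robust_err d \<gamma>' h D)
      = ?E (replicate_pmf n N) (\<lambda>T. ?E (?X T) (\<lambda>h. robust_err d \<gamma>' (hyp h) D))"
    using finNn H by (simp add: expectation_bind_finite_pmf set_pmf_exp_mech[OF H])
  also have "\<dots> \<le> ?E (replicate_pmf n N) (\<lambda>T. (Max ((\<lambda>h. \<Sum>z\<leftarrow>T. L h - nloss \<epsilon> z h) ` H)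
      + score \<epsilon> T h0 + ln (card H) / temp \<epsilon>) / n)"
  proof (rule expectation_mono_finite_pmf[OF finNn])
    fix T assume "T \<in> set_pmf (replicate_pmf n N)"
    then have lT: "length T = n" by (simp add: set_replicate_pmf)
    \<comment> \<open>The deviation is uniform over \<open>H\<close> for each fixed sample, so it
      also covers the hypothesis drawn by the mechanism, which depends on that sample.\<close>
    define G where "G = Max ((\<lambda>h. \<Sum>z\<leftarrow>T. L h - nloss \<epsilon> z h) ` H)"
    have "?E (?X T) (\<lambda>h. robust_err d \<gamma>' (hyp h) D) \<le> ?E (?X T) (\<lambda>h. (G + score \<epsilon> T h) / n)"
    proof (rule expectation_mono_finite_pmf)
      fix h assume "h \<in> set_pmf (?X T)"
      then have h: "h \<in> H" by (simp add: set_pmf_exp_mech[OF H])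
      have "n * L h - score \<epsilon> T h = (\<Sum>z\<leftarrow>T. L h - nloss \<epsilon> z h)"
        by (simp add: score_def sum_list_subtractf sum_list_triv lT)
      also have "\<dots> \<le> G" unfolding G_def using H h by (intro Max_ge) auto
      finally have "L h \<le> (G + score \<epsilon> T h) / n" using n by (simp add: field_simps)
      with err[OF h] show "robust_err d \<gamma>' (hyp h) D \<le> (G + score \<epsilon> T h) / n" by simp
    qed (use H in \<open>simp add: set_pmf_exp_mech[OF H]\<close>)
    also have "\<dots> = (G + ?E (?X T) (score \<epsilon> T)) / n"
      using H by (simp add: integrable_measure_pmf_finite set_pmf_exp_mech[OF H])
    also have "\<dots> \<le> (G + (score \<epsilon> T h0 + ln (card H) / temp \<epsilon>)) / n"
      using exp_mech_utility[OF H temp_pos[OF eps] h0, of "score \<epsilon> T"]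
      by (intro divide_right_mono) auto
    finally show "?E (?X T) (\<lambda>h. robust_err d \<gamma>' (hyp h) D)
      \<le> (G + score \<epsilon> T h0 + ln (card H) / temp \<epsilon>) / n" by (simp add: add.assoc)
  qed
  also have "\<dots> = (?E (replicate_pmf n N) (\<lambda>T. Max ((\<lambda>h. \<Sum>z\<leftarrow>T. L h - nloss \<epsilon> z h) ` H))
      + n * L h0 + ln (card H) / temp \<epsilon>) / n"
    using finNn expectation_sum_list_replicate_pmf[OF finN, of n "\<lambda>z. nloss \<epsilon> z h0"]
    by (simp add: integrable_measure_pmf_finite score_def LN)
  also have "\<dots> \<le> (48 / \<epsilon> * sqrt (b * n) + n * L h0 + 24 * b / \<epsilon>\<^sup>2) / n"
  proof (intro divide_right_mono add_mono order_refl)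
    have "?E (replicate_pmf n N) (\<lambda>T. Max ((\<lambda>h. 0 + (\<Sum>z\<leftarrow>T. L h - nloss \<epsilon> z h)) ` H))
      \<le> ?E (replicate_pmf n (pair_pmf N N)) (\<lambda>ps. rad H (map (\<lambda>(z, z') h. nloss \<epsilon> z' h - nloss \<epsilon> z h) ps) (\<lambda>_. 0))"
      unfolding LN by (rule symmetrization[OF H finN])
    also have "\<dots> \<le> 48 / \<epsilon> * sqrt (b * n)"
    proof (rule expectation_le_const_finite_pmf)
      fix ps assume "ps \<in> set_pmf (replicate_pmf n (pair_pmf N N))"
      then have lp: "length ps = n" by (simp add: set_replicate_pmf)
      with n have "ps \<noteq> []" by auto
      from rad_nloss_le[OF eps this]
      show "rad H (map (\<lambda>(z, z') h. nloss \<epsilon> z' h - nloss \<epsilon> z h) ps) (\<lambda>_. 0) \<le> 48 / \<epsilon> * sqrt (b * n)"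
        by (simp only: lp)
    qed (intro finite_set_replicate_pmf, use finN in simp)
    finally show "?E (replicate_pmf n N) (\<lambda>T. Max ((\<lambda>h. \<Sum>z\<leftarrow>T. L h - nloss \<epsilon> z h) ` H)) \<le> 48 / \<epsilon> * sqrt (b * n)"
      by simp
    note db = debias_bounds[OF eps]
    \<comment> \<open>The sensitivity \<open>s\<close> inside \<open>temp\<close> meets
      \<open>ln (card H)\<close> here, and only the product, bounded by \<open>b\<close>,
      survives.\<close>
    have "ln (card H) / temp \<epsilon> = 6 * (s * ln (card H)) * (debias_pos \<epsilon> + debias_neg \<epsilon>) / \<epsilon>"
      by (simp add: temp_def)
    also have "\<dots> \<le> (6 * b) * (4 / \<epsilon>) / \<epsilon>"
      using ln_H db b eps by (intro divide_right_mono mult_mono[of "6 * (s * ln (card H))"]) auto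
    finally show "ln (card H) / temp \<epsilon> \<le> 24 * b / \<epsilon>\<^sup>2" by (simp add: power2_eq_square)
  qed simp
  also have "\<dots> = L h0 + 48 * sqrt b / (\<epsilon> * sqrt n) + 24 * b / (\<epsilon>\<^sup>2 * n)"
  proof -
    have "sqrt (b * n) / n = sqrt b / sqrt n"
      using n by (simp add: real_sqrt_mult field_simps)
    then have "48 / \<epsilon> * (sqrt (b * n) / n) = 48 * sqrt b / (\<epsilon> * sqrt n)"
      by simp
    then show ?thesis using n by (simp add: add_divide_distrib)
  qed
  finally show ?thesis by (simp add: L_def)
qed

text \<open>\<open>dominates\<close> puts the ramp at 1 wherever a candidate errs at radius
  \<gamma>'; \<open>approximates\<close> puts the ramp of a suitable candidate at 0 wherever the
  competitor is robust at radius \<gamma>.\<close>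

lemma learnable:
  fixes \<gamma> \<gamma>' :: real
  assumes eps: "0 < \<epsilon>" "\<epsilon> \<le> 1" and n: "n \<ge> 1"
    and dominates: "\<And>h x y x'. h \<in> H \<Longrightarrow> (x, y) \<in> recdom d \<Longrightarrow> x' \<in> cube d \<Longrightarrow> hyp h x' \<noteq> y \<Longrightarrow>
      hamming x' x \<le> \<gamma>' * d \<Longrightarrow> g h (x, y) \<ge> 2 / 3"
    and approximates: "\<And>h. h \<in> halfspaces d \<Longrightarrow> \<exists>h0\<in>H. \<forall>x y. (x, y) \<in> recdom d \<longrightarrow>
      (\<forall>x'\<in>cube d. hamming x' x \<le> \<gamma> * d \<longrightarrow> h x' = y) \<longrightarrow> g h0 (x, y) \<le> 1 / 3"
  shows "learnable \<epsilon> \<gamma> \<gamma>' d n (48 * sqrt b / (\<epsilon> * sqrt n) + 24 * b / (\<epsilon>\<^sup>2 * n))"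
  unfolding learnable_def
proof (rule exI[of _ "learner \<epsilon>"], intro conjI allI impI ballI)
  fix D :: "(int list \<times> int) pmf" and h
  assume D: "set_pmf D \<subseteq> recdom d" and h: "h \<in> halfspaces d"
  let ?E = "measure_pmf.expectation"
  let ?A = "{(x, y). \<exists>x' \<in> cube d. h x' \<noteq> y \<and> real (hamming x' x) \<le> \<gamma> * real d}"
  obtain h0 where h0: "h0 \<in> H" "\<And>x y. (x, y) \<in> recdom d \<Longrightarrow>
      (\<forall>x'\<in>cube d. hamming x' x \<le> \<gamma> * d \<longrightarrow> h x' = y) \<Longrightarrow> g h0 (x, y) \<le> 1 / 3"
    using approximates[OF h] by auto
  have finD: "finite (set_pmf D)" using D finite_recdom(2) finite_subset by blast
  have "?E D (\<lambda>z. ramp (g h0 z)) \<le> ?E D (indicator ?A)"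
  proof (rule expectation_mono_finite_pmf[OF finD])
    fix z assume z: "z \<in> set_pmf D"
    obtain x y where xy: "z = (x, y)" by (cases z)
    show "ramp (g h0 z) \<le> indicator ?A z"
    proof (cases "z \<in> ?A")
      case False
      then have "g h0 (x, y) \<le> 1 / 3" using z D xy by (intro h0(2)) auto
      then show ?thesis using xy by (simp add: ramp_def)
    qed (simp add: ramp_bounds)
  qed
  also have "\<dots> = robust_err d \<gamma> h D" by (simp add: robust_err_def)
  finally show "?E (bind_pmf (replicate_pmf n D) (learner \<epsilon>)) (\<lambda>h. robust_err d \<gamma>' h D)
      \<le> robust_err d \<gamma> h D + (48 * sqrt b / (\<epsilon> * sqrt n) + 24 * b / (\<epsilon>\<^sup>2 * n))"
    using learner_utility[OF eps n D h0(1) dominates] by fastforce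
qed (use learner_range learner_attr_dp[OF eps] in auto)

end

section \<open>Low dimension: Chow parameters\<close>

text \<open>Unnormalised integer sums, so that the possible parameter vectors are easily
  counted.\<close>

definition chow :: "nat \<Rightarrow> (int list \<Rightarrow> int) \<Rightarrow> int list \<times> int" where
  "chow d h = (map (\<lambda>i. \<Sum>x\<in>cube d. h x * x ! i) [0..<d], \<Sum>x\<in>cube d. h x)"

text \<open>Chow's theorem: \<open>(h - h') \<langle>w, x\<rangle>\<close> is pointwise nonnegative and sums to zero, so \<open>h\<close> and \<open>h'\<close> can
  differ only where \<open>\<langle>w, x\<rangle> = 0\<close>; there \<open>h = 1 \<ge> h'\<close>, and the degree-zero parameter decides.\<close>
lemma halfspace_determined_by_chow:
  assumes w: "length w = d" and eq: "chow d (halfspace w) = chow d (halfspace w')" and x: "x \<in> cube d"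
  shows "halfspace w x = halfspace w' x"
proof -
  let ?h = "halfspace w" and ?h' = "halfspace w'"
  define ip where "ip x = (\<Sum>i<d. w ! i * real_of_int (x ! i))" for x :: "int list"
  have h: "?h x = (if ip x \<ge> 0 then 1 else -1)" for x by (simp add: halfspace_def ip_def w)
  have h': "?h' x \<in> {-1, 1}" for x by (simp add: halfspace_def)
  have c0: "(\<Sum>x\<in>cube d. ?h x - ?h' x) = 0"
    using eq by (simp add: chow_def sum_subtractf)
  have ci: "(\<Sum>x\<in>cube d. (?h x - ?h' x) * x ! i) = 0" if "i < d" for i
    using eq that by (simp add: chow_def sum_subtractf left_diff_distrib)
  have nonneg: "real_of_int (?h x - ?h' x) * ip x \<ge> 0" for x
    using h'[of x] by (auto simp: h)
  have "(\<Sum>x\<in>cube d. real_of_int (?h x - ?h' x) * ip x)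
      = (\<Sum>i<d. w ! i * real_of_int (\<Sum>x\<in>cube d. (?h x - ?h' x) * x ! i))"
    unfolding ip_def sum_distrib_left of_int_sum
    by (subst sum.swap) (simp add: mult_ac)
  also have "\<dots> = 0" using ci by simp
  finally have "\<forall>x\<in>cube d. real_of_int (?h x - ?h' x) * ip x = 0"
    using nonneg finite_recdom(1)[of d] by (subst (asm) sum_nonneg_eq_0_iff) auto
  then have z: "real_of_int (?h x - ?h' x) * ip x = 0" if "x \<in> cube d" for x using that by blast
  have "0 \<le> ?h x - ?h' x" if "x \<in> cube d" for x
    using z[OF that] h'[of x] by (auto simp: h split: if_splits)
  then have "\<forall>x\<in>cube d. ?h x - ?h' x = 0"
    using c0 finite_recdom(1)[of d] by (subst (asm) sum_nonneg_eq_0_iff) auto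
  then show ?thesis using x by simp
qed

lemma nth_cube: "x \<in> cube d \<Longrightarrow> i < d \<Longrightarrow> x ! i \<in> {-1, 1}"
  unfolding cube_def using nth_mem by blast

lemma card_cube: "card (cube d) = 2 ^ d"
proof -
  have "cube d = {x. set x \<subseteq> {-1, 1} \<and> length x = d}" by (auto simp: cube_def)
  then show ?thesis using card_lists_length_eq[of "{-1, 1 :: int}" d] by (simp add: numeral_2_eq_2)
qed

lemma chow_range:
  assumes "h \<in> halfspaces d"
  shows "chow d h \<in> {v. set v \<subseteq> {- (2 ^ d)..2 ^ d} \<and> length v = d} \<times> {- (2 ^ d)..2 ^ d}"
proof -
  have h: "\<bar>h x\<bar> \<le> 1" for x using assms by (auto simp: halfspaces_def halfspace_def)
  have bd: "\<bar>\<Sum>x\<in>cube d. u x\<bar> \<le> 2 ^ d" if "\<And>x. x \<in> cube d \<Longrightarrow> \<bar>u x\<bar> \<le> 1" for u :: "int list \<Rightarrow> int"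
  proof -
    have "\<bar>\<Sum>x\<in>cube d. u x\<bar> \<le> (\<Sum>x\<in>cube d. \<bar>u x\<bar>)" by (rule sum_abs)
    also have "\<dots> \<le> (\<Sum>x\<in>cube d. 1)" using that by (intro sum_mono) auto
    finally show ?thesis by (simp add: card_cube)
  qed
  have "\<bar>h x * x ! i\<bar> \<le> 1" if "x \<in> cube d" "i < d" for x i
  proof -
    have "x ! i \<in> {-1, 1}" by (rule nth_cube[OF that])
    then show ?thesis using h[of x] by auto
  qed
  then have "\<bar>\<Sum>x\<in>cube d. h x * x ! i\<bar> \<le> 2 ^ d" if "i < d" for i using that by (intro bd) auto
  then show ?thesis using bd[of h] h by (force simp: chow_def abs_le_iff)
qed

text \<open>One halfspace is kept for each attained vector of Chow parameters. There are at most
  \<open>(2 ^ (d + 1) + 1) ^ (d + 1)\<close> such vectors, so the log-cardinality is quadratic in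
  \<open>d\<close>.\<close>

lemma halfspace_representatives:
  obtains H where "H \<subseteq> halfspaces d" "finite H" "H \<noteq> {}" "ln (card H) \<le> (real d + 2)\<^sup>2"
    "\<And>h. h \<in> halfspaces d \<Longrightarrow> \<exists>h'\<in>H. \<forall>x\<in>cube d. h' x = h x"
proof -
  define R :: "(int list \<times> int) set" where
    "R = {v. set v \<subseteq> {- (2 ^ d)..2 ^ d} \<and> length v = d} \<times> {- (2 ^ d)..2 ^ d}"
  have cI: "card {- (2 ^ d)..2 ^ d :: int} = 2 ^ (d + 1) + 1"
    by (simp add: nat_add_distrib nat_mult_distrib nat_power_eq)
  have R: "finite R" "card R = (2 ^ (d + 1) + 1) ^ (d + 1)"
    unfolding R_def using cI
    by (simp_all add: finite_lists_length_eq card_cartesian_product card_lists_length_eq mult.commute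
        del: card_atLeastAtMost_int)
  obtain H where H: "H \<subseteq> halfspaces d" "inj_on (chow d) H" "chow d ` halfspaces d = chow d ` H"
    using subset_image_inj[of "chow d ` halfspaces d" "chow d" "halfspaces d"] by auto
  have sub: "chow d ` H \<subseteq> R" using H(1) chow_range unfolding R_def by blast
  have finH: "finite H" using H(2) sub R(1) by (meson finite_imageD finite_subset)
  have ne: "H \<noteq> {}"
  proof -
    have "halfspace (replicate d 0) \<in> halfspaces d" by (auto simp: halfspaces_def)
    then show ?thesis using H(3) by auto
  qed
  have "card H = card (chow d ` H)" using H(2) by (simp add: card_image)
  also have "\<dots> \<le> card R" by (rule card_mono[OF R(1) sub])
  finally have "real (card H) \<le> (2 ^ (d + 1) + 1) ^ (d + 1)"
    unfolding R(2) by (metis (mono_tags) of_nat_le_iff of_nat_add of_nat_power of_nat_numeral of_nat_1)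
  also have "\<dots> \<le> ((2 :: real) ^ (d + 2)) ^ (d + 1)"
  proof (rule power_mono)
    have "(1::real) \<le> 2 ^ (d + 1)" by (rule one_le_power) simp
    then show "(2 :: real) ^ (d + 1) + 1 \<le> 2 ^ (d + 2)" by simp
  qed simp
  also have "\<dots> = 2 ^ ((d + 2) * (d + 1))" by (simp only: power_mult)
  finally have le: "real (card H) \<le> 2 ^ ((d + 2) * (d + 1))" .
  have cH: "card H > 0" using finH ne by (simp add: card_gt_0_iff)
  have "ln (card H) \<le> ln (2 ^ ((d + 2) * (d + 1)) :: real)" using le cH by (subst ln_le_cancel_iff) auto
  also have "\<dots> = real ((d + 2) * (d + 1)) * ln 2" by (rule ln_realpow)
  also have "\<dots> \<le> real ((d + 2) * (d + 1)) * 1"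
    using ln_le_minus_one[of "2::real"] by (intro mult_left_mono) auto
  also have "\<dots> \<le> (real d + 2)\<^sup>2" by (simp add: power2_eq_square algebra_simps)
  finally have ln: "ln (card H) \<le> (real d + 2)\<^sup>2" .
  have "\<exists>h'\<in>H. \<forall>x\<in>cube d. h' x = h x" if h: "h \<in> halfspaces d" for h
  proof -
    obtain h' where h': "h' \<in> H" "chow d h = chow d h'" using h H(3) by (metis imageE imageI)
    obtain w w' where "length w = d" "h = halfspace w" "h' = halfspace w'"
      using h h' H(1) by (fastforce simp: halfspaces_def)
    then show ?thesis using h' halfspace_determined_by_chow[of w d w'] by (intro bexI[of _ h']) auto
  qed
  then show ?thesis using that H(1) finH ne ln by blast
qed

lemma hamming_zero_cube: "x \<in> cube d \<Longrightarrow> x' \<in> cube d \<Longrightarrow> hamming x x' = 0 \<Longrightarrow> x = x'"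
  by (auto simp: hamming_def cube_def intro: nth_equalityI)

lemma learnable_low_dim:
  fixes \<gamma> \<gamma>' :: real
  assumes eps: "0 < \<epsilon>" "\<epsilon> \<le> 1" and n: "n \<ge> 1" and \<gamma>: "\<gamma>' \<le> \<gamma>"
  shows "learnable \<epsilon> \<gamma> \<gamma>' d n (48 * (real d + 2) / (\<epsilon> * sqrt n) + 24 * (real d + 2)\<^sup>2 / (\<epsilon>\<^sup>2 * n))"
proof -
  obtain H where reps: "H \<subseteq> halfspaces d" "finite H" "H \<noteq> {}" "ln (card H) \<le> (real d + 2)\<^sup>2"
    "\<And>h. h \<in> halfspaces d \<Longrightarrow> \<exists>h'\<in>H. \<forall>x\<in>cube d. h' x = h x"
    using halfspace_representatives[of d] by metis
  define err where "err = (\<lambda>h (x, y). if \<exists>x'\<in>cube d. h x' \<noteq> (y :: int) \<and> real (hamming x' x) \<le> \<gamma>' * real d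
    then 1 else 0 :: real)"
  have err: "\<bar>err h z\<bar> \<le> 1" for h z by (cases z) (simp add: err_def)
  \<comment> \<open>No projection is made: the average is over a point mass and \<open>\<pi>\<close>
    is the identity. Sensitivity 1 suffices because a 0-1 loss changes by at most 1 and distinct
    cube points are at distance at least 1.\<close>
  interpret projected_class d "\<lambda>h. h" H "return_pmf ()" "\<lambda>_. err" "\<lambda>_ h. h" 1 "(real d + 2)\<^sup>2" err
  proof
    fix h :: "int list \<Rightarrow> int" and x x' y assume x: "x \<in> cube d" "x' \<in> cube d"
    show "\<bar>err h (x, y) - err h (x', y)\<bar> \<le> 1 * real (hamming x x')"
    proof (cases "x = x'")
      case False
      then have "hamming x x' \<ge> 1" using hamming_zero_cube[OF x] by force
      moreover have "\<bar>err h (x, y) - err h (x', y)\<bar> \<le> 1" by (auto simp: err_def)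
      ultimately show ?thesis by simp
    qed simp
  qed (use reps err in auto)
  have "learnable \<epsilon> \<gamma> \<gamma>' d n (48 * sqrt ((real d + 2)\<^sup>2) / (\<epsilon> * sqrt n) + 24 * (real d + 2)\<^sup>2 / (\<epsilon>\<^sup>2 * n))"
  proof (rule learnable[OF eps n])
    fix h :: "int list \<Rightarrow> int" and x y x' assume "x' \<in> cube d" "h x' \<noteq> y" "real (hamming x' x) \<le> \<gamma>' * real d"
    then show "err h (x, y) \<ge> 2 / 3" by (auto simp: err_def)
  next
    fix h assume h: "h \<in> halfspaces d"
    obtain h' where h': "h' \<in> H" "\<forall>x\<in>cube d. h' x = h x" using reps(5)[OF h] by auto
    have "\<gamma>' * real d \<le> \<gamma> * real d" using \<gamma> by (intro mult_right_mono) auto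
    then show "\<exists>h0\<in>H. \<forall>x y. (x, y) \<in> recdom d \<longrightarrow>
      (\<forall>x'\<in>cube d. hamming x' x \<le> \<gamma> * d \<longrightarrow> h x' = y) \<longrightarrow> err h0 (x, y) \<le> 1 / 3"
      using h' by (intro bexI[of _ h']) (force simp: err_def)+
  qed
  then show ?thesis by simp
qed

section \<open>Sampling coordinates\<close>

text \<open>Variances of independent terms add up: after centring, the cross terms have mean zero,
  and each term has variance at most 1.\<close>

lemma expectation_deviation_square_le:
  fixes a :: "'a \<Rightarrow> real"
  assumes D: "finite (set_pmf D)" and a: "\<And>z. z \<in> set_pmf D \<Longrightarrow> \<bar>a z\<bar> \<le> 1"
  defines "\<mu> \<equiv> measure_pmf.expectation D a"
  shows "measure_pmf.expectation (replicate_pmf k D) (\<lambda>S. ((\<Sum>z\<leftarrow>S. a z) - k * \<mu>)\<^sup>2) \<le> k"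
proof -
  let ?E = "measure_pmf.expectation"
  define c where "c z = a z - \<mu>" for z
  have intD: "integrable (measure_pmf D) (u :: 'a \<Rightarrow> real)" for u using D by (rule integrable_measure_pmf_finite)
  have c0: "?E D c = 0" using intD unfolding c_def[abs_def] by (simp add: \<mu>_def)
  have c2: "?E D (\<lambda>z. (c z)\<^sup>2) \<le> 1"
  proof -
    have "?E D (\<lambda>z. (c z)\<^sup>2) = ?E D (\<lambda>z. (a z)\<^sup>2 + (\<mu>\<^sup>2 - 2 * \<mu> * a z))"
      by (simp add: c_def power2_diff algebra_simps)
    also have "\<dots> = ?E D (\<lambda>z. (a z)\<^sup>2) - \<mu>\<^sup>2"
      using intD by (simp add: \<mu>_def[symmetric] power2_eq_square)
    also have "\<dots> \<le> ?E D (\<lambda>z. (a z)\<^sup>2)" by simp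
    also have "\<dots> \<le> 1" using D a by (intro expectation_le_const_finite_pmf) (auto simp: abs_square_le_1)
    finally show ?thesis .
  qed
  have "?E (replicate_pmf k D) (\<lambda>S. (\<Sum>z\<leftarrow>S. c z)\<^sup>2) \<le> k"
  proof (induction k)
    case (Suc k)
    have intk: "integrable (measure_pmf (replicate_pmf k D)) (u :: 'a list \<Rightarrow> real)" for u
      by (rule integrable_measure_pmf_finite[OF finite_set_replicate_pmf[OF D]])
    have s0: "?E (replicate_pmf k D) (\<lambda>S. \<Sum>z\<leftarrow>S. c z) = 0"
      using expectation_sum_list_replicate_pmf[OF D, of k c] c0 by simp
    have "?E (replicate_pmf (Suc k) D) (\<lambda>S. (\<Sum>z\<leftarrow>S. c z)\<^sup>2)
        = ?E D (\<lambda>z. ?E (replicate_pmf k D) (\<lambda>S. (c z)\<^sup>2 + (2 * c z * (\<Sum>z\<leftarrow>S. c z) + (\<Sum>z\<leftarrow>S. c z)\<^sup>2)))"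
      unfolding expectation_replicate_pmf_Suc[OF D] by (simp add: power2_sum algebra_simps)
    also have "\<dots> = ?E D (\<lambda>z. (c z)\<^sup>2) + ?E (replicate_pmf k D) (\<lambda>S. (\<Sum>z\<leftarrow>S. c z)\<^sup>2)"
      using intk intD s0 by simp
    also have "\<dots> \<le> 1 + real k" using c2 Suc by (rule add_mono)
    finally show ?case by simp
  qed simp
  moreover have "(\<Sum>z\<leftarrow>S. c z) = (\<Sum>z\<leftarrow>S. a z) - k * \<mu>" if "S \<in> set_pmf (replicate_pmf k D)" for S
    using that by (simp add: c_def sum_list_subtractf sum_list_triv set_replicate_pmf)
  then have "?E (replicate_pmf k D) (\<lambda>S. (\<Sum>z\<leftarrow>S. c z)\<^sup>2)
      = ?E (replicate_pmf k D) (\<lambda>S. ((\<Sum>z\<leftarrow>S. a z) - k * \<mu>)\<^sup>2)"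
    by (intro integral_cong_AE) (auto simp: AE_measure_pmf_iff)
  ultimately show ?thesis by simp
qed

text \<open>Chebyshev for two sums at once: Markov's inequality for the sum of the two squared
  deviations gives \<open>2 * k / (\<eta> * k)\<^sup>2 \<le> 1 / 3\<close>, whence the constant 6.
  The bad event is described by being incompatible with both sums being close to their
  means.\<close>

lemma sample_two_sums_concentrate:
  fixes a a' :: "'a \<Rightarrow> real" and \<eta> :: real
  assumes D: "finite (set_pmf D)" and a: "\<And>z. z \<in> set_pmf D \<Longrightarrow> \<bar>a z\<bar> \<le> 1" "\<And>z. z \<in> set_pmf D \<Longrightarrow> \<bar>a' z\<bar> \<le> 1"
    and \<eta>: "\<eta> > 0" and k: "6 \<le> \<eta>\<^sup>2 * k"
    and E: "\<And>S. S \<in> E \<Longrightarrow> S \<in> set_pmf (replicate_pmf k D) \<Longrightarrow>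
      \<bar>(\<Sum>z\<leftarrow>S. a z) - k * measure_pmf.expectation D a\<bar> \<le> \<eta> * k \<Longrightarrow>
      \<bar>(\<Sum>z\<leftarrow>S. a' z) - k * measure_pmf.expectation D a'\<bar> \<le> \<eta> * k \<Longrightarrow> False"
  shows "measure_pmf.prob (replicate_pmf k D) E \<le> 1 / 3"
proof -
  let ?E = "measure_pmf.expectation (replicate_pmf k D)"
  define V where "V a S = ((\<Sum>z\<leftarrow>S. a z) - k * measure_pmf.expectation D a)\<^sup>2" for S and a :: "'a \<Rightarrow> real"
  have k0: "real k > 0" using k by (cases "k = 0") auto
  define q where "q = (\<eta> * k)\<^sup>2"
  have q: "q > 0" using \<eta> k0 by (simp add: q_def)
  have fin: "finite (set_pmf (replicate_pmf k D))" by (rule finite_set_replicate_pmf[OF D])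
  have big: "V a S \<ge> q" if "\<not> \<bar>(\<Sum>z\<leftarrow>S. a z) - k * measure_pmf.expectation D a\<bar> \<le> \<eta> * k" for a S
    using that \<eta> k0 power_mono[of "\<eta> * k" "\<bar>(\<Sum>z\<leftarrow>S. a z) - k * measure_pmf.expectation D a\<bar>" 2]
    by (simp add: V_def q_def)
  have V_le: "?E (V a) \<le> k" "?E (V a') \<le> k"
    unfolding V_def[abs_def] by (rule expectation_deviation_square_le[OF D], fact a)+
  have nn: "V a S \<ge> 0" for a S by (simp add: V_def)
  have "measure_pmf.prob (replicate_pmf k D) E = ?E (indicator E)" by simp
  also have "\<dots> \<le> ?E (\<lambda>S. (V a S + V a' S) / q)"
  proof (rule expectation_mono_finite_pmf[OF fin])
    fix S assume S: "S \<in> set_pmf (replicate_pmf k D)"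
    show "indicator E S \<le> (V a S + V a' S) / q"
    proof (cases "S \<in> E")
      case True
      then have "V a S \<ge> q \<or> V a' S \<ge> q" using E[OF True S] big by blast
      then have "V a S + V a' S \<ge> q" using nn[of a S] nn[of a' S] by linarith
      then show ?thesis using q True by simp
    qed (use q nn in simp)
  qed
  also have "\<dots> = (?E (V a) + ?E (V a')) / q"
    using fin by (simp add: integrable_measure_pmf_finite)
  also have "\<dots> \<le> (real k + real k) / q"
    using V_le q by (intro divide_right_mono add_mono) auto
  also have "\<dots> = 2 / (\<eta>\<^sup>2 * k)" using k0 \<eta> by (simp add: q_def power2_eq_square)
  also have "\<dots> \<le> 2 / 6" using k by (intro divide_left_mono) auto
  finally show ?thesis by simp
qed

text \<open>Linear programming duality for the sum of the \<open>m\<close> largest values: an optimal set \<open>F\<close> together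
  with its threshold \<open>\<theta>\<close>.\<close>
lemma top_set_threshold:
  fixes p :: "'a \<Rightarrow> real"
  assumes A: "finite A" and B: "B \<ge> 0" "\<And>i. i \<in> A \<Longrightarrow> p i \<le> B"
  shows "\<exists>F \<theta>. F \<subseteq> A \<and> card F \<le> m \<and> 0 \<le> \<theta> \<and> \<theta> \<le> B \<and> (card F = m \<or> \<theta> = 0) \<and>
    (\<forall>i\<in>F. \<theta> \<le> p i) \<and> (\<forall>i\<in>A - F. p i \<le> \<theta>)"
proof (induction m)
  case 0
  show ?case using B by (intro exI[of _ "{}"] exI[of _ B]) auto
next
  case (Suc m)
  then obtain F \<theta> where F: "F \<subseteq> A" "card F \<le> m" "0 \<le> \<theta>" "\<theta> \<le> B" "card F = m \<or> \<theta> = 0"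
    "\<forall>i\<in>F. \<theta> \<le> p i" "\<forall>i\<in>A - F. p i \<le> \<theta>" by auto
  show ?case
  proof (cases "\<forall>i\<in>A - F. p i \<le> 0")
    case True
    then show ?thesis using F B by (intro exI[of _ F] exI[of _ 0]) auto
  next
    case False
    then obtain i0 where i0: "i0 \<in> A - F" "p i0 > 0" by auto
    have "Max (p ` (A - F)) \<in> p ` (A - F)" using A i0 by (intro Max_in) auto
    then obtain j where j: "j \<in> A - F" "p j = Max (p ` (A - F))" by auto
    have jm: "p i \<le> p j" if "i \<in> A - F" for i using A that unfolding j(2) by (intro Max_ge) auto
    have "p j > 0" using jm[OF i0(1)] i0(2) by simp
    have "finite F" using F(1) A finite_subset by blast
    moreover have pj: "p j \<le> \<theta>" using F(7) j(1) by blast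
    moreover have "card F = m" using F(5) pj \<open>p j > 0\<close> by linarith
    ultimately have c: "card (insert j F) = Suc m" using j(1) by simp
    have "\<forall>i\<in>insert j F. p j \<le> p i" using F(6) pj by force
    moreover have "\<forall>i\<in>A - insert j F. p i \<le> p j" using jm by blast
    moreover have "insert j F \<subseteq> A" using F(1) j(1) by blast
    moreover have "p j \<le> B" using B(2) j(1) by blast
    ultimately show ?thesis
      using c \<open>p j > 0\<close> by (intro exI[of _ "insert j F"] exI[of _ "p j"]) simp
  qed
qed

definition signed :: "'a set \<Rightarrow> ('a \<Rightarrow> real) \<Rightarrow> 'a \<Rightarrow> real" where
  "signed F p i = (if i \<in> F then - p i else p i)"

lemma sum_signed:
  assumes "finite A" "F \<subseteq> A"
  shows "(\<Sum>i\<in>A. signed F p i) = (\<Sum>i\<in>A. p i) - 2 * (\<Sum>i\<in>F. p i)"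
proof -
  have "(\<Sum>i\<in>A. signed F p i) = (\<Sum>i\<in>A. p i - 2 * (if i \<in> F then p i else 0))"
    by (intro sum.cong) (auto simp: signed_def)
  also have "\<dots> = (\<Sum>i\<in>A. p i) - 2 * (\<Sum>i\<in>A. if i \<in> F then p i else 0)"
    by (simp add: sum_subtractf sum_distrib_left)
  also have "(\<Sum>i\<in>A. if i \<in> F then p i else 0) = (\<Sum>i\<in>F. p i)"
    using assms by (simp add: sum.If_cases Int_absorb1)
  finally show ?thesis .
qed

lemma sum_indicator_subset: "finite A \<Longrightarrow> B \<subseteq> A \<Longrightarrow> (\<Sum>i\<in>A. indicator B i :: real) = card B"
proof -
  assume "finite A" "B \<subseteq> A"
  then have "(\<Sum>i\<in>A. indicator B i :: real) = (\<Sum>i\<in>B. 1)"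
    by (intro sum.mono_neutral_cong_right) auto
  then show ?thesis by simp
qed

text \<open>The adversary's move on a sample of \<open>k\<close> coordinates: at most \<open>c\<close> flips that bring the margin down to \<open>r\<close>.\<close>
definition fragile :: "nat \<Rightarrow> real \<Rightarrow> real \<Rightarrow> (nat \<Rightarrow> real) \<Rightarrow> bool" where
  "fragile k c r q \<longleftrightarrow> (\<exists>J\<subseteq>{..<k}. real (card J) \<le> c \<and> (\<Sum>j<k. signed J q j) \<le> r)"

lemma sum_list_map_index:
  fixes p :: "'a \<Rightarrow> real"
  shows "length I = k \<Longrightarrow> (\<Sum>i\<leftarrow>I. p i) = (\<Sum>j<k. p (I ! j))"
  by (simp add: sum_list_sum_nth atLeast0LessThan)

definition sampler :: "nat \<Rightarrow> nat \<Rightarrow> nat list pmf" where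
  "sampler d k = replicate_pmf k (pmf_of_set {..<d})"

lemma expectation_uniform:
  fixes a :: "nat \<Rightarrow> real"
  assumes "d > 0"
  shows "measure_pmf.expectation (pmf_of_set {..<d}) a = (\<Sum>i<d. a i) / d"
proof -
  have "{..<d} \<noteq> {}" using assms by auto
  then show ?thesis using integral_pmf_of_set[of "{..<d}" a] by simp
qed

text \<open>The attack \<open>F\<close> on all coordinates is restricted to the sample. The number
  of sampled flips and the sampled margin after flipping are sums of fixed functions, so both
  concentrate; the slack \<open>\<eta>\<close> in both parameters of \<open>fragile\<close> absorbs
  the deviations.\<close>

lemma sampler_fragile:
  fixes \<eta> :: real
  assumes d: "d > 0" and p: "\<And>i. i < d \<Longrightarrow> \<bar>p i\<bar> \<le> 1" and \<eta>: "\<eta> > 0" "6 \<le> \<eta>\<^sup>2 * k"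
    and F: "F \<subseteq> {..<d}" "card F \<le> m" "(\<Sum>i<d. signed F p i) \<le> 0"
  shows "measure_pmf.prob (sampler d k) {I. fragile k ((m / d + \<eta>) * k) (\<eta> * k) (\<lambda>j. p (I ! j))} \<ge> 2 / 3"
proof -
  let ?A = "{I. fragile k ((m / d + \<eta>) * k) (\<eta> * k) (\<lambda>j. p (I ! j))}"
  let ?D = "pmf_of_set {..<d}"
  have ne: "{..<d} \<noteq> {}" using d by auto
  have "measure_pmf.prob (sampler d k) (- ?A) \<le> 1 / 3"
    unfolding sampler_def
  proof (rule sample_two_sums_concentrate[where a = "indicator F" and a' = "signed F p"])
    fix I assume I: "I \<in> - ?A" "I \<in> set_pmf (replicate_pmf k ?D)"
    assume 1: "\<bar>(\<Sum>z\<leftarrow>I. indicator F z) - k * measure_pmf.expectation ?D (indicator F)\<bar> \<le> \<eta> * k"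
      and 2: "\<bar>(\<Sum>z\<leftarrow>I. signed F p z) - k * measure_pmf.expectation ?D (signed F p)\<bar> \<le> \<eta> * k"
    have lI: "length I = k" using I(2) by (simp add: set_replicate_pmf)
    define J where "J = {j. j < k \<and> I ! j \<in> F}"
    have "(\<Sum>z\<leftarrow>I. indicator F z) = (\<Sum>j<k. indicator J j :: real)"
      unfolding sum_list_map_index[OF lI] by (intro sum.cong) (auto simp: J_def indicator_def)
    also have "\<dots> = card J" by (rule sum_indicator_subset) (auto simp: J_def)
    finally have cJ: "(\<Sum>z\<leftarrow>I. indicator F z) = real (card J)" .
    have "measure_pmf.expectation ?D (indicator F) = card F / d"
      using sum_indicator_subset[OF _ F(1)] expectation_uniform[OF d, of "indicator F"] by simp
    also have "\<dots> \<le> m / d" using F(2) by (intro divide_right_mono) auto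
    finally have "k * measure_pmf.expectation ?D (indicator F) \<le> k * (m / d)" by (intro mult_left_mono) auto
    with 1 cJ have J: "card J \<le> (m / d + \<eta>) * k" by (simp add: algebra_simps)
    have "measure_pmf.expectation ?D (signed F p) \<le> 0"
      using F(3) d by (simp add: expectation_uniform divide_nonpos_pos)
    then have "k * measure_pmf.expectation ?D (signed F p) \<le> 0" by (simp add: mult_nonneg_nonpos)
    moreover have "(\<Sum>z\<leftarrow>I. signed F p z) = (\<Sum>j<k. signed J (\<lambda>j. p (I ! j)) j)"
      unfolding sum_list_map_index[OF lI] by (intro sum.cong) (auto simp: J_def signed_def)
    ultimately have "(\<Sum>j<k. signed J (\<lambda>j. p (I ! j)) j) \<le> \<eta> * k" using 2 by linarith
    then have "I \<in> ?A" using J by (auto simp: fragile_def J_def intro!: exI[of _ J])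
    then show False using I(1) by simp
  qed (use ne \<eta> p in \<open>auto simp: signed_def indicator_def\<close>)
  then show ?thesis using measure_pmf.prob_compl[of ?A "sampler d k"] by (simp add: Compl_eq_Diff_UNIV)
qed

text \<open>The attack \<open>J\<close> depends on the sample, yet no union bound is made. By
  duality any \<open>J\<close> gains at most \<open>\<theta>\<close> per flip plus the sampled
  excess \<open>q\<close> over \<open>\<theta>\<close>. As \<open>p\<close> and \<open>q\<close> are
  fixed functions, concentration of two sums controls all \<open>J\<close> simultaneously.\<close>

lemma sampler_not_fragile:
  fixes \<eta> M :: real
  assumes d: "d > 0" and p: "\<And>i. i < d \<Longrightarrow> \<bar>p i\<bar> \<le> 1" and \<eta>: "\<eta> > 0" "6 \<le> \<eta>\<^sup>2 * k"
    and M: "6 * \<eta> * d < M" "\<And>F. F \<subseteq> {..<d} \<Longrightarrow> card F \<le> m \<Longrightarrow> M \<le> (\<Sum>i<d. signed F p i)"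
  shows "measure_pmf.prob (sampler d k) {I. fragile k ((m / d + \<eta>) * k) (\<eta> * k) (\<lambda>j. p (I ! j))} \<le> 1 / 3"
proof -
  let ?D = "pmf_of_set {..<d}"
  have ne: "{..<d} \<noteq> {}" using d by auto
  have "\<And>i. i \<in> {..<d} \<Longrightarrow> p i \<le> 1" using p by (force simp: abs_le_iff)
  then obtain F \<theta> where F: "F \<subseteq> {..<d}" "card F \<le> m" "0 \<le> \<theta>" "\<theta> \<le> 1" "card F = m \<or> \<theta> = 0"
    "\<forall>i\<in>F. \<theta> \<le> p i" "\<forall>i\<in>{..<d} - F. p i \<le> \<theta>"
    using top_set_threshold[of "{..<d}" 1 p m] by auto
  define q where "q i = max 0 (p i - \<theta>)" for i
  have q: "\<bar>q i\<bar> \<le> 1" if "i < d" for i using p[OF that] F(3) by (auto simp: q_def)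
  have "(\<Sum>i<d. q i) = (\<Sum>i\<in>F. q i)"
    using F(1,7) by (intro sum.mono_neutral_right) (auto simp: q_def)
  also have "\<dots> = (\<Sum>i\<in>F. p i - \<theta>)" using F(6) by (intro sum.cong) (auto simp: q_def)
  \<comment> \<open>Complementary slackness: either \<open>card F = m\<close> or
    \<open>\<theta> = 0\<close>.\<close>
  also have "\<dots> = (\<Sum>i\<in>F. p i) - m * \<theta>" using F(5) by (auto simp: sum_subtractf)
  finally have sq: "(\<Sum>i<d. q i) = (\<Sum>i\<in>F. p i) - m * \<theta>" .
  have "M \<le> (\<Sum>i<d. p i) - 2 * (\<Sum>i\<in>F. p i)"
    using M(2)[OF F(1,2)] sum_signed[of "{..<d}" F p] F(1) by simp
  then have margin: "M + 2 * (m * \<theta>) + 2 * (\<Sum>i<d. q i) \<le> (\<Sum>i<d. p i)" using sq by simp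
  show ?thesis unfolding sampler_def
  proof (rule sample_two_sums_concentrate[where a = p and a' = q])
    fix I assume I: "I \<in> {I. fragile k ((m / d + \<eta>) * k) (\<eta> * k) (\<lambda>j. p (I ! j))}"
      "I \<in> set_pmf (replicate_pmf k ?D)"
    assume 1: "\<bar>(\<Sum>z\<leftarrow>I. p z) - k * measure_pmf.expectation ?D p\<bar> \<le> \<eta> * k"
      and 2: "\<bar>(\<Sum>z\<leftarrow>I. q z) - k * measure_pmf.expectation ?D q\<bar> \<le> \<eta> * k"
    have lI: "length I = k" using I(2) by (simp add: set_replicate_pmf)
    obtain J where J: "J \<subseteq> {..<k}" "card J \<le> (m / d + \<eta>) * k" "(\<Sum>j<k. signed J (\<lambda>j. p (I ! j)) j) \<le> \<eta> * k"
      using I(1) by (auto simp: fragile_def)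
    have finJ: "finite J" using J(1) finite_subset by blast
    have "(\<Sum>j\<in>J. p (I ! j)) \<le> (\<Sum>j\<in>J. \<theta> + q (I ! j))" by (intro sum_mono) (simp add: q_def)
    also have "\<dots> = card J * \<theta> + (\<Sum>j\<in>J. q (I ! j))" by (simp add: sum.distrib)
    also have "\<dots> \<le> ((m / d + \<eta>) * k) * \<theta> + (\<Sum>j<k. q (I ! j))"
      using J(1,2) F(3) by (intro add_mono mult_right_mono sum_mono2) (auto simp: q_def)
    also have "(\<Sum>j<k. q (I ! j)) \<le> k * ((\<Sum>i<d. q i) / d) + \<eta> * k"
      using 2 d unfolding sum_list_map_index[OF lI] by (simp add: expectation_uniform)
    finally have top: "(\<Sum>j\<in>J. p (I ! j)) \<le> ((m / d + \<eta>) * k) * \<theta> + (k * ((\<Sum>i<d. q i) / d) + \<eta> * k)" by simp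
    have "\<eta> * k \<ge> (\<Sum>j<k. p (I ! j)) - 2 * (\<Sum>j\<in>J. p (I ! j))"
      using J(3) sum_signed[OF _ J(1), of "\<lambda>j. p (I ! j)"] by simp
    moreover have "(\<Sum>j<k. p (I ! j)) \<ge> k * ((\<Sum>i<d. p i) / d) - \<eta> * k"
      using 1 d unfolding sum_list_map_index[OF lI] by (simp add: expectation_uniform)
    moreover have "k * ((\<Sum>i<d. p i) / d) \<ge> k * ((M + 2 * (m * \<theta>) + 2 * (\<Sum>i<d. q i)) / d)"
      using margin by (intro mult_left_mono divide_right_mono) auto
    moreover have "k * ((M + 2 * (m * \<theta>) + 2 * (\<Sum>i<d. q i)) / d)
        = k * (M / d) + 2 * ((m / d) * k * \<theta>) + 2 * (k * ((\<Sum>i<d. q i) / d))"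
      using d by (simp add: field_simps)
    moreover have "\<eta> * k * \<theta> \<le> \<eta> * k"
      using \<eta> F(3,4) mult_left_mono[of \<theta> 1 "\<eta> * k"] by simp
    moreover have "(m / d + \<eta>) * k * \<theta> = (m / d) * k * \<theta> + \<eta> * k * \<theta>" by (simp add: algebra_simps)
    \<comment> \<open>The six units of \<open>\<eta> * k\<close>: one from the threshold of
      \<open>fragile\<close>, one from the deviation of \<open>p\<close>, two from the deviation of
      \<open>q\<close>, and two from the extra flips allowed to \<open>J\<close>; the last two enter
      doubled, since a flip changes a sum by twice the value.\<close>
    ultimately have "k * (M / d) \<le> 6 * (\<eta> * k)" using top by linarith
    moreover have "k * (6 * \<eta>) < k * (M / d)"
    proof (rule mult_strict_left_mono)
      show "6 * \<eta> < M / d" using M(1) d by (simp add: field_simps)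
      show "real k > 0" using \<eta>(2) by (cases "k = 0") auto
    qed
    ultimately show False by (simp add: algebra_simps)
  qed (use ne \<eta> p q in auto)
qed

section \<open>High dimension: robust margins\<close>

lemma inner_halfspace:
  "length w = d \<Longrightarrow> halfspace w x = (if (\<Sum>i<d. w ! i * real_of_int (x ! i)) \<ge> 0 then 1 else -1)"
  by (simp add: halfspace_def)

lemma finite_sampler: "d > 0 \<Longrightarrow> finite (set_pmf (sampler d k))"
  unfolding sampler_def by (rule finite_set_replicate_pmf) (subst set_pmf_of_set, auto)

lemma set_pmf_sampler: "d > 0 \<Longrightarrow> I \<in> set_pmf (sampler d k) \<Longrightarrow> length I = k \<and> set I \<subseteq> {..<d}"
  unfolding sampler_def by (subst (asm) set_replicate_pmf, subst (asm) set_pmf_of_set) auto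

definition grid :: "nat \<Rightarrow> real set" where
  "grid K = (\<lambda>j. real_of_int j / real K) ` {- int K..int K}"

lemma grid: "finite (grid K)" "card (grid K) \<le> 2 * K + 1" "0 \<in> grid K"
  unfolding grid_def by (auto intro!: order_trans[OF card_image_le] image_eqI[of _ _ 0])

lemma grid_rounding:
  assumes K: "K > 0" and v: "\<bar>v\<bar> \<le> 1"
  shows "\<exists>u\<in>grid K. \<bar>u - v\<bar> \<le> 1 / K"
proof -
  define j where "j = \<lfloor>v * K\<rfloor>"
  have "v * K \<le> K" "- real K \<le> v * K" using v K by (auto simp: abs_le_iff)
       (use mult_right_mono[of "-1" v "real K"] in auto)
  then have "j \<in> {- int K..int K}" unfolding j_def by (auto simp: le_floor_iff floor_le_iff)
  moreover have "\<bar>j / K - v\<bar> \<le> 1 / K"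
  proof -
    have "\<bar>real_of_int j - v * K\<bar> \<le> 1" unfolding j_def by linarith
    moreover have "\<bar>j / K - v\<bar> = \<bar>real_of_int j - v * K\<bar> / K"
    proof -
      have "j / K - v = (real_of_int j - v * K) / K" using K by (simp add: field_simps)
      then show ?thesis by (simp add: abs_divide)
    qed
    ultimately show ?thesis using K by (simp add: divide_right_mono)
  qed
  ultimately show ?thesis unfolding grid_def by blast
qed

lemma grid_bound: "u \<in> grid K \<Longrightarrow> \<bar>u\<bar> \<le> 1"
  unfolding grid_def by (cases "K = 0") (auto simp: abs_le_iff field_simps)

definition flip :: "nat set \<Rightarrow> int list \<Rightarrow> int list" where
  "flip B x = map (\<lambda>i. if i \<in> B then - (x ! i) else x ! i) [0..<length x]"

lemma nth_flip: "i < length x \<Longrightarrow> flip B x ! i = (if i \<in> B then - (x ! i) else x ! i)"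
  by (simp add: flip_def)

lemma flip_cube: "x \<in> cube d \<Longrightarrow> flip B x \<in> cube d"
  by (auto simp: flip_def cube_def) (metis add.inverse_inverse insertE nth_mem singletonD subset_iff)+

lemma hamming_flip_le: "finite B \<Longrightarrow> hamming (flip B x) x \<le> card B"
  unfolding hamming_def by (rule card_mono) (auto simp: flip_def split: if_splits)

text \<open>A robust halfspace cannot rely on its \<open>t\<close> heaviest coordinates \<open>T\<close>: the adversary turns all of them
  against the label. So they can be dropped, and relative to the largest remaining weight the margin is \<open>t\<close>.\<close>
lemma robust_margin:
  fixes \<theta> :: real
  assumes w: "length w = d" and xy: "(x, y) \<in> recdom d"
    and robust: "\<And>x'. x' \<in> cube d \<Longrightarrow> hamming x' x \<le> m + t \<Longrightarrow> halfspace w x' = y"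
    and T: "T \<subseteq> {..<d}" "card T \<le> t" "\<And>i. i \<in> T \<Longrightarrow> \<theta> \<le> \<bar>w ! i\<bar>" and F: "F \<subseteq> {..<d}" "card F \<le> m"
  shows "(\<Sum>i\<in>T. \<bar>w ! i\<bar>) \<le> (\<Sum>i\<in>{..<d} - T. signed F (\<lambda>i. y * w ! i * real_of_int (x ! i)) i)"
proof -
  have x: "x \<in> cube d" and y: "y \<in> {-1, 1}" using xy by (auto simp: recdom_def)
  then have lx: "length x = d" by (simp add: cube_def)
  define p where "p i = y * w ! i * real_of_int (x ! i)" for i
  define B where "B = (F - T) \<union> {i\<in>T. p i > 0}"
  have fin: "finite T" "finite F" using T(1) F(1) finite_subset by blast+
  have "card B \<le> card (F - T) + card {i\<in>T. p i > 0}" unfolding B_def by (rule card_Un_le)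
  also have "\<dots> \<le> card F + card T" using fin by (intro add_mono card_mono) auto
  finally have "card B \<le> m + t" using T(2) F(2) by simp
  moreover have "finite B" using fin by (simp add: B_def)
  ultimately have "hamming (flip B x) x \<le> m + t" using hamming_flip_le[of B x] by simp
  then have "halfspace w (flip B x) = y" using robust flip_cube[OF x] by blast
  then have "0 \<le> y * (\<Sum>i<d. w ! i * real_of_int (flip B x ! i))"
    using y by (auto simp: inner_halfspace[OF w] split: if_splits)
  also have "\<dots> = (\<Sum>i<d. signed B p i)"
    unfolding sum_distrib_left by (intro sum.cong) (auto simp: nth_flip lx signed_def p_def)
  also have "\<dots> = (\<Sum>i\<in>{..<d} - T. signed B p i) + (\<Sum>i\<in>T. signed B p i)"
    using T(1) by (subst sum.subset_diff[of T]) auto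
  also have "(\<Sum>i\<in>T. signed B p i) = (\<Sum>i\<in>T. - \<bar>w ! i\<bar>)"
  proof (rule sum.cong)
    fix i assume i: "i \<in> T"
    then have "i < d" using T(1) by auto
    then have "x ! i \<in> {-1, 1}" by (rule nth_cube[OF x])
    then have "\<bar>p i\<bar> = \<bar>w ! i\<bar>" using y by (auto simp: p_def abs_mult)
    then show "signed B p i = - \<bar>w ! i\<bar>" using i by (auto simp: signed_def B_def)
  qed simp
  also have "(\<Sum>i\<in>{..<d} - T. signed B p i) = (\<Sum>i\<in>{..<d} - T. signed F p i)"
    by (intro sum.cong) (auto simp: signed_def B_def)
  finally show ?thesis by (simp add: sum_negf p_def[abs_def])
qed

section \<open>The sampled score of a weight vector\<close>

definition proj :: "nat list \<Rightarrow> real list \<Rightarrow> bool \<times> real list" where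
  "proj I w = ((\<forall>a\<in>set w. a = 0), map ((!) w) I)"

text \<open>The zero weight vector is the constant classifier \<open>1\<close>, which is robust without any margin; hence the
  separate flag.\<close>
definition fscore :: "nat \<Rightarrow> real \<Rightarrow> real \<Rightarrow> nat list \<Rightarrow> bool \<times> real list \<Rightarrow> int list \<times> int \<Rightarrow> real" where
  "fscore k c r I v z = (if fst v then if snd z = 1 then 0 else 1
     else if fragile k c r (\<lambda>j. snd z * snd v ! j * real_of_int (fst z ! (I ! j))) then 1 else 0)"

lemma fragile_cong: "(\<And>j. j < k \<Longrightarrow> q j = q' j) \<Longrightarrow> fragile k c r q = fragile k c r q'"
  unfolding fragile_def by (intro ex_cong1 conj_cong refl arg_cong2[where f = "(\<le>)"] sum.cong) (auto simp: signed_def)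

definition gscore :: "nat \<Rightarrow> nat \<Rightarrow> real \<Rightarrow> real \<Rightarrow> real list \<Rightarrow> int list \<times> int \<Rightarrow> real" where
  "gscore d k c r w z = measure_pmf.expectation (sampler d k) (\<lambda>I. fscore k c r I (proj I w) z)"

lemma gscore_zero:
  assumes "\<forall>a\<in>set w. a = 0"
  shows "gscore d k c r w z = (if snd z = 1 then 0 else 1)"
  using assms by (simp add: gscore_def fscore_def proj_def)

lemma gscore_nonzero:
  assumes d: "d > 0" and w: "\<not> (\<forall>a\<in>set w. a = 0)"
  shows "gscore d k c r w (x, y)
    = measure_pmf.prob (sampler d k) {I. fragile k c r (\<lambda>j. y * w ! (I ! j) * real_of_int (x ! (I ! j)))}"
proof -
  let ?A = "{I. fragile k c r (\<lambda>j. y * w ! (I ! j) * real_of_int (x ! (I ! j)))}"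
  have "gscore d k c r w (x, y) = measure_pmf.expectation (sampler d k) (indicator ?A)"
    unfolding gscore_def
  proof (rule integral_cong_AE)
    show "AE I in measure_pmf (sampler d k). fscore k c r I (proj I w) (x, y) = indicator ?A I"
      unfolding AE_measure_pmf_iff
    proof
      fix I assume "I \<in> set_pmf (sampler d k)"
      then have "length I = k" using set_pmf_sampler[OF d] by blast
      then have "fragile k c r (\<lambda>j. y * snd (proj I w) ! j * real_of_int (x ! (I ! j)))
          = fragile k c r (\<lambda>j. y * w ! (I ! j) * real_of_int (x ! (I ! j)))"
        by (intro fragile_cong) (simp add: proj_def)
      then show "fscore k c r I (proj I w) (x, y) = indicator ?A I"
        using w by (auto simp: fscore_def proj_def indicator_def)
    qed
  qed auto
  then show ?thesis by simp
qed

text \<open>The sampled value can change only if one of the \<open>k\<close> random coordinates hits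
  a place where \<open>x\<close> and \<open>x'\<close> differ; the expected number of such hits is
  the bound.\<close>

lemma gscore_lipschitz:
  assumes d: "d > 0" and x: "x \<in> cube d" "x' \<in> cube d"
  shows "\<bar>gscore d k c r w (x, y) - gscore d k c r w (x', y)\<bar> \<le> k / d * hamming x x'"
proof -
  let ?E = "measure_pmf.expectation (sampler d k)"
  define B where "B = {i. i < d \<and> x ! i \<noteq> x' ! i}"
  have B: "card B = hamming x x'" using x by (auto simp: B_def hamming_def cube_def)
  note fin = finite_sampler[OF d, of k]
  let ?f = "\<lambda>x I. fscore k c r I (proj I w) (x, y)"
  have "\<bar>gscore d k c r w (x, y) - gscore d k c r w (x', y)\<bar> = \<bar>?E (\<lambda>I. ?f x I - ?f x' I)\<bar>"
    unfolding gscore_def using fin by (simp add: integrable_measure_pmf_finite)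
  also have "\<dots> \<le> ?E (\<lambda>I. \<bar>?f x I - ?f x' I\<bar>)" by (rule integral_abs_bound)
  also have "\<dots> \<le> ?E (\<lambda>I. \<Sum>i\<leftarrow>I. indicator B i)"
  proof (rule expectation_mono_finite_pmf[OF fin])
    fix I assume "I \<in> set_pmf (sampler d k)"
    then have I: "length I = k" "set I \<subseteq> {..<d}" using set_pmf_sampler[OF d] by blast+
    have nn: "(\<Sum>i\<leftarrow>I. indicator B i) \<ge> (0::real)" by (intro sum_list_nonneg) auto
    show "\<bar>?f x I - ?f x' I\<bar> \<le> (\<Sum>i\<leftarrow>I. indicator B i)"
    proof (cases "\<exists>i\<in>set I. i \<in> B")
      case True
      then obtain i where "i \<in> set I" "i \<in> B" by auto
      then have "(1::real) \<le> (\<Sum>i\<leftarrow>I. indicator B i)"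
        using member_le_sum_list[of "1::real" "map (indicator B) I"] by force
      moreover have "\<bar>?f x I - ?f x' I\<bar> \<le> 1" by (auto simp: fscore_def)
      ultimately show ?thesis by simp
    next
      case False
      then have "x ! (I ! j) = x' ! (I ! j)" if "j < k" for j
      proof -
        have "I ! j \<in> set I" using that I(1) by simp
        then show ?thesis using False I(2) by (auto simp: B_def)
      qed
      then have "fragile k c r (\<lambda>j. y * snd (proj I w) ! j * real_of_int (x ! (I ! j)))
          = fragile k c r (\<lambda>j. y * snd (proj I w) ! j * real_of_int (x' ! (I ! j)))"
        by (intro fragile_cong) simp
      then have "?f x I = ?f x' I" by (simp add: fscore_def)
      then show ?thesis using nn by simp
    qed
  qed
  also have "\<dots> = k * ((\<Sum>i<d. indicator B i) / d)"
  proof -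
    have "finite (set_pmf (pmf_of_set {..<d}))" using d by (subst set_pmf_of_set) auto
    from expectation_sum_list_replicate_pmf[OF this, of k "indicator B"] show ?thesis
      using expectation_uniform[OF d, of "indicator B"] by (simp add: sampler_def)
  qed
  also have "(\<Sum>i<d. indicator B i :: real) = hamming x x'"
    unfolding B[symmetric] by (rule sum_indicator_subset) (auto simp: B_def)
  finally show ?thesis by simp
qed

text \<open>The coordinates in which \<open>x'\<close> differs from \<open>x\<close> form an attack
  that makes the signed margin nonpositive, and \<open>sampler_fragile\<close> transfers it to most
  samples. For the zero vector the flag gives the exact answer.\<close>

lemma gscore_dominates:
  fixes \<eta> :: real
  assumes d: "d > 0" and w: "length w = d" "set w \<subseteq> grid K" and xy: "(x, y) \<in> recdom d"
    and x': "x' \<in> cube d" "halfspace w x' \<noteq> y" "hamming x' x \<le> m" and \<eta>: "\<eta> > 0" "6 \<le> \<eta>\<^sup>2 * k"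
  shows "gscore d k ((m / d + \<eta>) * k) (\<eta> * k) w (x, y) \<ge> 2 / 3"
proof (cases "\<forall>a\<in>set w. a = 0")
  case True
  then have "w ! i = 0" if "i < d" for i using that w(1) by auto
  then have "halfspace w x' = 1" by (simp add: inner_halfspace[OF w(1)])
  then show ?thesis using x'(2) True by (simp add: gscore_zero)
next
  case False
  have x: "x \<in> cube d" and y: "y \<in> {-1, 1}" using xy by (auto simp: recdom_def)
  define p where "p i = y * w ! i * real_of_int (x ! i)" for i
  define B where "B = {i. i < d \<and> x' ! i \<noteq> x ! i}"
  have p: "\<bar>p i\<bar> \<le> 1" if "i < d" for i
  proof -
    have "\<bar>w ! i\<bar> \<le> 1" using that w grid_bound by (metis nth_mem subsetD)
    then show ?thesis using nth_cube[OF x that] y by (auto simp: p_def abs_mult)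
  qed
  have "card B = hamming x' x" using x x'(1) by (auto simp: B_def hamming_def cube_def)
  then have cB: "card B \<le> m" using x'(3) by simp
  have "(\<Sum>i<d. signed B p i) = y * (\<Sum>i<d. w ! i * real_of_int (x' ! i))"
    unfolding sum_distrib_left
  proof (intro sum.cong refl)
    fix i assume "i \<in> {..<d}"
    then have i: "i < d" by simp
    show "signed B p i = y * (w ! i * real_of_int (x' ! i))"
      using nth_cube[OF x i] nth_cube[OF x'(1) i] i by (auto simp: signed_def B_def p_def)
  qed
  also have "\<dots> \<le> 0" using x'(2) y by (auto simp: inner_halfspace[OF w(1)] split: if_splits)
  finally have "measure_pmf.prob (sampler d k) {I. fragile k ((m / d + \<eta>) * k) (\<eta> * k) (\<lambda>j. p (I ! j))} \<ge> 2 / 3"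
    by (intro sampler_fragile[OF d p \<eta> _ cB]) (auto simp: B_def)
  then show ?thesis using gscore_nonzero[OF d False] by (simp add: p_def)
qed

text \<open>The \<open>t\<close> heaviest coordinates are dropped and the others divided by the
  threshold weight \<open>\<theta>\<close>, which puts them into [-1, 1]; by
  \<open>robust_margin\<close> the remaining margin is at least \<open>t\<close>. Rounding to the
  grid costs at most \<open>d / K\<close>.\<close>

lemma gscore_approximates:
  fixes \<eta> :: real
  assumes d: "d > 0" and h: "h \<in> halfspaces d" and K: "K > 0" and \<eta>: "\<eta> > 0" "6 \<le> \<eta>\<^sup>2 * k"
    and M: "6 * \<eta> * d < t - d / K"
  shows "\<exists>w. length w = d \<and> set w \<subseteq> grid K \<and> (\<forall>x y. (x, y) \<in> recdom d \<longrightarrow>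
    (\<forall>x'\<in>cube d. hamming x' x \<le> m + t \<longrightarrow> h x' = y) \<longrightarrow>
    gscore d k ((m / d + \<eta>) * k) (\<eta> * k) w (x, y) \<le> 1 / 3)"
proof -
  obtain w where w: "length w = d" "h = halfspace w" using h by (auto simp: halfspaces_def)
  have zero: "set (replicate d 0) \<subseteq> grid K" using grid(3) by auto
  have "\<bar>w ! i\<bar> \<le> (\<Sum>i<d. \<bar>w ! i\<bar>)" if "i \<in> {..<d}" for i
    using that by (intro member_le_sum) auto
  then obtain T \<theta> where T: "T \<subseteq> {..<d}" "card T \<le> t" "0 \<le> \<theta>" "card T = t \<or> \<theta> = 0"
    "\<forall>i\<in>T. \<theta> \<le> \<bar>w ! i\<bar>" "\<forall>i\<in>{..<d} - T. \<bar>w ! i\<bar> \<le> \<theta>"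
    using top_set_threshold[of "{..<d}" "\<Sum>i<d. \<bar>w ! i\<bar>" "\<lambda>i. \<bar>w ! i\<bar>" t] by (auto simp: sum_nonneg)
  have margin: "(\<Sum>i\<in>T. \<bar>w ! i\<bar>) \<le> (\<Sum>i\<in>{..<d} - T. signed F (\<lambda>i. y * w ! i * real_of_int (x ! i)) i)"
    if "(x, y) \<in> recdom d" "\<forall>x'\<in>cube d. hamming x' x \<le> m + t \<longrightarrow> h x' = y" "F \<subseteq> {..<d}" "card F \<le> m" for x y F
    by (rule robust_margin[OF w(1) that(1) _ T(1,2) _ that(3,4), of \<theta>]) (use that(2) w(2) T(5) in auto)
  show ?thesis
  proof (cases "\<theta> = 0")
    \<comment> \<open>All weights outside \<open>T\<close> vanish, so the margin inequality at a
      robust example forces those in \<open>T\<close> to vanish too. Then \<open>h\<close> is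
      constantly 1 and the zero vector reproduces it.\<close>
    case True
    have off: "w ! i = 0" if "i \<in> {..<d} - T" for i using T(6) that True by auto
    have "gscore d k ((m / d + \<eta>) * k) (\<eta> * k) (replicate d 0) (x, y) \<le> 1 / 3"
      if xy: "(x, y) \<in> recdom d" and r: "\<forall>x'\<in>cube d. hamming x' x \<le> m + t \<longrightarrow> h x' = y" for x y
    proof -
      have "(\<Sum>i\<in>{..<d} - T. signed {} (\<lambda>i. y * w ! i * real_of_int (x ! i)) i) = 0"
        using off by (intro sum.neutral) (auto simp: signed_def)
      then have "(\<Sum>i\<in>T. \<bar>w ! i\<bar>) \<le> 0" using margin[OF xy r, of "{}"] by simp
      moreover have "finite T" using T(1) finite_subset by blast
      ultimately have "\<bar>w ! i\<bar> = 0" if "i \<in> T" for i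
        using that sum_nonneg_eq_0_iff[of T "\<lambda>i. \<bar>w ! i\<bar>"] by (simp add: sum_nonneg order_antisym)
      with off have "w ! i = 0" if "i < d" for i using that by (cases "i \<in> T") auto
      then have "h x = 1" using w by (simp add: inner_halfspace[OF w(1)])
      moreover have "h x = y" using xy r by (auto simp: recdom_def hamming_def)
      ultimately show ?thesis by (simp add: gscore_zero)
    qed
    then show ?thesis using zero by (intro exI[of _ "replicate d 0"]) auto
  next
    case False
    then have \<theta>: "\<theta> > 0" "card T = t" using T(3,4) by auto
    define v where "v i = (if i \<in> T then 0 else w ! i / \<theta>)" for i
    have v: "\<bar>v i\<bar> \<le> 1" if "i < d" for i using T(6) \<theta> that by (auto simp: v_def)
    have "\<exists>u. \<forall>i<d. u i \<in> grid K \<and> \<bar>u i - v i\<bar> \<le> 1 / K"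
      using grid_rounding[OF K v] by (metis (no_types))
    then obtain u where u: "\<And>i. i < d \<Longrightarrow> u i \<in> grid K \<and> \<bar>u i - v i\<bar> \<le> 1 / K" by auto
    define w0 where "w0 = map u [0..<d]"
    have w0: "length w0 = d" "set w0 \<subseteq> grid K" using u by (auto simp: w0_def)
    have "gscore d k ((m / d + \<eta>) * k) (\<eta> * k) w0 (x, y) \<le> 1 / 3"
      if xy: "(x, y) \<in> recdom d" and r: "\<forall>x'\<in>cube d. hamming x' x \<le> m + t \<longrightarrow> h x' = y" for x y
    proof -
      have x: "x \<in> cube d" and y: "y \<in> {-1, 1}" using xy by (auto simp: recdom_def)
      define p where "p i = y * w0 ! i * real_of_int (x ! i)" for i
      have p: "\<bar>p i\<bar> \<le> 1" if "i < d" for i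
        using nth_cube[OF x that] y grid_bound[of "u i" K] u[OF that] that by (auto simp: p_def abs_mult w0_def)
      have low: "t - d / K \<le> (\<Sum>i<d. signed F p i)" if F: "F \<subseteq> {..<d}" "card F \<le> m" for F
      proof -
        have "t * \<theta> = (\<Sum>i\<in>T. \<theta>)" using \<theta> by simp
        also have "\<dots> \<le> (\<Sum>i\<in>T. \<bar>w ! i\<bar>)" using T(5) by (intro sum_mono) auto
        also have "\<dots> \<le> (\<Sum>i\<in>{..<d} - T. signed F (\<lambda>i. y * w ! i * real_of_int (x ! i)) i)"
          by (rule margin[OF xy r F])
        also have "\<dots> = (\<Sum>i\<in>{..<d} - T. \<theta> * signed F (\<lambda>i. y * v i * real_of_int (x ! i)) i)"
          using \<theta> by (intro sum.cong) (auto simp: signed_def v_def)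
        also have "\<dots> = \<theta> * (\<Sum>i<d. signed F (\<lambda>i. y * v i * real_of_int (x ! i)) i)"
          unfolding sum_distrib_left using T(1)
          by (intro sum.mono_neutral_left) (auto simp: signed_def v_def)
        finally have "t \<le> (\<Sum>i<d. signed F (\<lambda>i. y * v i * real_of_int (x ! i)) i)" using \<theta> by (simp add: mult.commute)
        also have "\<dots> \<le> (\<Sum>i<d. signed F p i + 1 / K)"
        proof (rule sum_mono)
          fix i assume "i \<in> {..<d}"
          then have i: "i < d" by simp
          have "y * v i * real_of_int (x ! i) = v i \<and> p i = u i \<or> y * v i * real_of_int (x ! i) = - v i \<and> p i = - u i"
            using y nth_cube[OF x i] i by (auto simp: p_def w0_def)
          moreover have "(if i \<in> F then - q else q) \<le> (if i \<in> F then - p i else p i) + 1 / K"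
            if "q = v i \<and> p i = u i \<or> q = - v i \<and> p i = - u i" for q
            using that u[OF i] by auto
          ultimately show "signed F (\<lambda>i. y * v i * real_of_int (x ! i)) i \<le> signed F p i + 1 / K"
            unfolding signed_def by blast
        qed
        also have "\<dots> = (\<Sum>i<d. signed F p i) + d / K" by (simp add: sum.distrib)
        finally show ?thesis by simp
      qed
      \<comment> \<open>A positive margin shows that rounding did not produce the zero vector, which
        the flag would treat differently.\<close>
      have pos: "t - d / K > 0" using M \<eta> d by (smt (verit) mult_nonneg_nonneg of_nat_0_le_iff)
      have nz: "\<not> (\<forall>a\<in>set w0. a = 0)"
      proof
        assume "\<forall>a\<in>set w0. a = 0"
        then have "p i = 0" if "i < d" for i using that w0(1) by (auto simp: p_def)
        then have "(\<Sum>i<d. signed {} p i) = 0" by (simp add: signed_def)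
        then show False using low[of "{}"] pos by simp
      qed
      have "measure_pmf.prob (sampler d k) {I. fragile k ((m / d + \<eta>) * k) (\<eta> * k) (\<lambda>j. p (I ! j))} \<le> 1 / 3"
        by (rule sampler_not_fragile[OF d p \<eta> M low])
      then show ?thesis using gscore_nonzero[OF d nz] by (simp add: p_def)
    qed
    then show ?thesis using w0 by (intro exI[of _ w0]) auto
  qed
qed

section \<open>The learner in high dimension\<close>

lemma ln_card_grid_lists:
  assumes "H \<subseteq> {u. set u \<subseteq> grid K \<and> length u = l}" "H \<noteq> {}"
  shows "finite H" "ln (card H) \<le> real l * (2 * real K)"
proof -
  let ?G = "{u. set u \<subseteq> grid K \<and> length u = l}"
  have G: "finite ?G" using grid(1) by (rule finite_lists_length_eq)
  then show fin: "finite H" using assms(1) finite_subset by blast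
  have "card H \<le> card ?G" by (rule card_mono[OF G assms(1)])
  also have "\<dots> = card (grid K) ^ l" using grid(1) by (rule card_lists_length_eq)
  also have "\<dots> \<le> (2 * K + 1) ^ l" using grid(2) by (intro power_mono) auto
  finally have "real (card H) \<le> (1 + 2 * real K) ^ l"
    by (metis (mono_tags) add.commute of_nat_1 of_nat_add of_nat_le_iff of_nat_mult of_nat_numeral of_nat_power)
  moreover have "card H > 0" using fin assms(2) by (simp add: card_gt_0_iff)
  ultimately have "ln (card H) \<le> ln ((1 + 2 * real K) ^ l)" by simp
  also have "\<dots> = l * ln (1 + 2 * real K)" by (rule ln_realpow)
  \<comment> \<open>A linear bound for the logarithm is affordable: with \<open>k\<close> of order
    \<open>1 / \<Delta>\<^sup>2\<close> and \<open>K\<close> of order \<open>1 / \<Delta>\<close>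
    for the gap \<Delta> between \<gamma> and \<gamma>', \<open>b\<close> has order
    \<open>1 / \<Delta> ^ 3\<close>, while the final rate tolerates
    \<open>1 / \<Delta> ^ 4\<close>.\<close>
  also have "\<dots> \<le> real l * (2 * real K)"
    using ln_add_one_self_le_self[of "2 * real K"] by (intro mult_left_mono) simp_all
  finally show "ln (card H) \<le> real l * (2 * real K)" .
qed

lemma learnable_high_dim:
  fixes \<gamma> \<gamma>' \<eta> :: real and k K t :: nat
  assumes eps: "0 < \<epsilon>" "\<epsilon> \<le> 1" and n: "n \<ge> 1" and d: "d > 0" and k: "k > 0" and K: "K > 0"
    and \<eta>: "\<eta> > 0" "6 \<le> \<eta>\<^sup>2 * k" and M: "6 * \<eta> * d < t - d / K"
    and \<gamma>: "0 \<le> \<gamma>'" "t \<le> (\<gamma> - \<gamma>') * d" and b: "b = k * (2 * real K + 1)"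
  shows "learnable \<epsilon> \<gamma> \<gamma>' d n (48 * sqrt b / (\<epsilon> * sqrt n) + 24 * b / (\<epsilon>\<^sup>2 * n))"
proof -
  \<comment> \<open>Hamming distances are integers, so rounding the radius down admits the same
    attacks.\<close>
  define m where "m = nat \<lfloor>\<gamma>' * d\<rfloor>"
  have m: "real m \<le> \<gamma>' * d" using \<gamma>(1) by (simp add: m_def)
  have le_m: "j \<le> m" if "real j \<le> \<gamma>' * d" for j unfolding m_def using that by (rule le_nat_floor)
  define c where "c = (m / d + \<eta>) * k"
  define W where "W = {w. set w \<subseteq> grid K \<and> length w = d}"
  have W0: "W \<noteq> {}" using grid(3)[of K] by (auto simp: W_def intro!: exI[of _ "replicate d 0"])
  note W = ln_card_grid_lists[of W K d, OF _ W0]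
  have sW: "W \<subseteq> {u. set u \<subseteq> grid K \<and> length u = d}" by (simp add: W_def)
  interpret projected_class d halfspace W "sampler d k" "fscore k c (\<eta> * k)" proj "k / d" b "gscore d k c (\<eta> * k)"
  proof
    fix I assume "I \<in> set_pmf (sampler d k)"
    then have I: "length I = k" "set I \<subseteq> {..<d}" using set_pmf_sampler[OF d] by blast+
    define U where "U = (\<lambda>w. map ((!) w) I) ` W"
    have sU: "U \<subseteq> {u. set u \<subseteq> grid K \<and> length u = k}"
    proof
      fix u assume "u \<in> U"
      then obtain w where w: "w \<in> W" "u = map ((!) w) I" by (auto simp: U_def)
      have "w ! i \<in> grid K" if "i \<in> set I" for i
      proof -
        have "i < length w" using that I(2) w(1) by (auto simp: W_def)
        then show ?thesis using w(1) nth_mem[of i w] unfolding W_def by blast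
      qed
      then show "u \<in> {u. set u \<subseteq> grid K \<and> length u = k}" using w(2) I(1) by auto
    qed
    have U0: "U \<noteq> {}" using W0 by (simp add: U_def)
    note U = ln_card_grid_lists[OF sU U0]
    have "proj I ` W \<subseteq> UNIV \<times> U" by (auto simp: proj_def U_def)
    then have "card (proj I ` W) \<le> card ((UNIV :: bool set) \<times> U)"
      using U(1) by (intro card_mono) auto
    also have "\<dots> = 2 * card U" by (simp add: card_cartesian_product)
    finally have "real (card (proj I ` W)) \<le> 2 * real (card U)" by linarith
    moreover have "card (proj I ` W) > 0" using W(1)[OF sW] W0 by (simp add: card_gt_0_iff)
    moreover have cU: "card U > 0" using U(1) U0 by (simp add: card_gt_0_iff)
    ultimately have "ln (card (proj I ` W)) \<le> ln (2 * real (card U))" by simp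
    also have "\<dots> = ln 2 + ln (card U)" using cU by (simp add: ln_mult)
    also have "\<dots> \<le> 1 + real k * (2 * real K)" using U(2) ln_le_minus_one[of "2::real"] by simp
    \<comment> \<open>The summand \<open>k\<close> in \<open>b\<close> pays for the zero flag, which
      at most doubles the projected class.\<close>
    also have "\<dots> \<le> b" using k by (simp add: b algebra_simps)
    finally show "ln (card (proj I ` W)) \<le> b" .
  next
    \<comment> \<open>The cancellation of the dimension: sensitivity \<open>k / d\<close> against
      log-cardinality of order \<open>d\<close>.\<close>
    have "k / d * ln (card W) \<le> k / d * (real d * (2 * real K))"
      using W(2)[OF sW] by (intro mult_left_mono) auto
    also have "\<dots> \<le> b" using d by (simp add: b algebra_simps)
    finally show "k / d * ln (card W) \<le> b" .
  next
    show "\<bar>fscore k c (\<eta> * k) I v z\<bar> \<le> 1" for I v z by (simp add: fscore_def)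
    show "halfspace w \<in> halfspaces d" if "w \<in> W" for w using that by (auto simp: W_def halfspaces_def)
    show "b > 0" using k by (simp add: b)
  qed (use W(1)[OF sW] W0 finite_sampler[OF d] gscore_lipschitz[OF d] d k in \<open>auto simp: gscore_def\<close>)
  show ?thesis
  proof (rule learnable[OF eps n])
    fix w x y x'
    assume "w \<in> W" "(x, y) \<in> recdom d" "x' \<in> cube d" "halfspace w x' \<noteq> y" "real (hamming x' x) \<le> \<gamma>' * real d"
    then show "gscore d k c (\<eta> * k) w (x, y) \<ge> 2 / 3"
      unfolding c_def using le_m by (intro gscore_dominates[OF d _ _ _ _ _ _ \<eta>, where K = K]) (auto simp: W_def)
  next
    fix h assume h: "h \<in> halfspaces d"
    obtain w where w: "length w = d" "set w \<subseteq> grid K" "\<And>x y. (x, y) \<in> recdom d \<Longrightarrow>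
      (\<forall>x'\<in>cube d. hamming x' x \<le> m + t \<longrightarrow> h x' = y) \<Longrightarrow> gscore d k c (\<eta> * k) w (x, y) \<le> 1 / 3"
      using gscore_approximates[OF d h K \<eta> M, of m] unfolding c_def by blast
    have "real (m + t) \<le> \<gamma> * d" using m \<gamma>(2) by (simp add: left_diff_distrib)
    then have "real (hamming x' x) \<le> \<gamma> * d" if "hamming x' x \<le> m + t" for x' x :: "int list"
      using that by linarith
    then show "\<exists>h0\<in>W. \<forall>x y. (x, y) \<in> recdom d \<longrightarrow>
      (\<forall>x'\<in>cube d. hamming x' x \<le> \<gamma> * d \<longrightarrow> h x' = y) \<longrightarrow> gscore d k c (\<eta> * k) h0 (x, y) \<le> 1 / 3"
      using w by (intro bexI[of _ w]) (auto simp: W_def)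
  qed
qed

section \<open>Choice of parameters and the final bound\<close>

lemma learnable_mono:
  assumes "learnable \<epsilon> \<gamma> \<gamma>' d n B" "B \<le> B'"
  shows "learnable \<epsilon> \<gamma> \<gamma>' d n B'"
  using assms(1) unfolding learnable_def Ball_def
  by (elim ex_forward conj_forward all_forward imp_forward) (use assms(2) in auto)

lemma robust_err_bounds: "0 \<le> robust_err d \<gamma> h D" "robust_err d \<gamma> h D \<le> 1"
  by (simp_all add: robust_err_def)

lemma zero_halfspace_in: "halfspace (replicate d 0) \<in> halfspaces d"
  by (auto simp: halfspaces_def)

lemma learnable_trivial:
  assumes "\<epsilon> \<ge> 0"
  shows "learnable \<epsilon> \<gamma> \<gamma>' d n 1"
  unfolding learnable_def attr_dp_def
proof (intro exI[of _ "\<lambda>_. return_pmf (halfspace (replicate d 0))"] conjI allI impI ballI)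
  fix S S' :: "(int list \<times> int) list" and i E
  have "1 \<le> exp (\<epsilon> * real (attr_dist (S ! i) (S' ! i)))" using assms by simp
  then show "measure_pmf.prob (return_pmf (halfspace (replicate d 0))) E
      \<le> exp (\<epsilon> * real (attr_dist (S ! i) (S' ! i))) * measure_pmf.prob (return_pmf (halfspace (replicate d 0))) E"
    by (metis mult_right_mono mult_1 measure_nonneg)
next
  fix D :: "(int list \<times> int) pmf" and h
  show "measure_pmf.expectation (bind_pmf (replicate_pmf n D) (\<lambda>_. return_pmf (halfspace (replicate d 0))))
      (\<lambda>h. robust_err d \<gamma>' h D) \<le> robust_err d \<gamma> h D + 1"
    using robust_err_bounds(2)[of d \<gamma>' "halfspace (replicate d 0)" D] robust_err_bounds(1)[of d \<gamma> h D] by simp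
qed (simp add: zero_halfspace_in)

lemma learnable_bound:
  fixes \<gamma> \<gamma>' :: real
  assumes eps: "0 < \<epsilon>" "\<epsilon> \<le> 1" and n: "n \<ge> 1" and \<gamma>: "0 < \<gamma>'" "\<gamma>' < \<gamma>" "\<gamma> \<le> 1"
  shows "learnable \<epsilon> \<gamma> \<gamma>' d n (2200000 / (\<epsilon> * sqrt n * (\<gamma> - \<gamma>')\<^sup>2))"
proof -
  define \<Delta> where "\<Delta> = \<gamma> - \<gamma>'"
  have \<Delta>: "0 < \<Delta>" "\<Delta> \<le> 1" using \<gamma> by (auto simp: \<Delta>_def)
  define u where "u = 1 / (\<epsilon> * sqrt n * \<Delta>\<^sup>2)"
  have u: "u > 0" using eps n \<Delta> by (simp add: u_def)
  \<comment> \<open>For \<open>u \<le> 1\<close> the quadratic term is absorbed by the linear one: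
    48 * 300 + 24 * 300^2 = 2174400.\<close>
  have rate: "48 * r / (\<epsilon> * sqrt n) + 24 * r\<^sup>2 / (\<epsilon>\<^sup>2 * n) \<le> 2200000 * u"
    if r: "0 \<le> r" "r \<le> 300 / \<Delta>\<^sup>2" and u1: "u \<le> 1" for r
  proof -
    define v where "v = r / (\<epsilon> * sqrt n)"
    have "v \<le> (300 / \<Delta>\<^sup>2) / (\<epsilon> * sqrt n)"
      unfolding v_def using r eps by (intro divide_right_mono) auto
    also have "\<dots> = 300 * u" by (simp add: u_def mult.commute)
    finally have v: "0 \<le> v" "v \<le> 300 * u" using r eps by (auto simp: v_def)
    have "v\<^sup>2 \<le> (300 * u)\<^sup>2" using v by (intro power_mono) auto
    also have "\<dots> \<le> 90000 * u" using u u1 by (simp add: power2_eq_square)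
    finally have "48 * v + 24 * v\<^sup>2 \<le> 2200000 * u" using v by linarith
    then show ?thesis using eps n by (simp add: v_def power_divide power_mult_distrib)
  qed
  have "learnable \<epsilon> \<gamma> \<gamma>' d n (2200000 * u)"
  proof (cases "u \<le> 1")
    case False
    then show ?thesis using learnable_mono[OF learnable_trivial[of \<epsilon>]] eps by simp
  next
    case u1: True
    have sq: "1 / \<Delta> \<le> 1 / \<Delta>\<^sup>2" "1 \<le> 1 / \<Delta>" "1 \<le> 1 / \<Delta>\<^sup>2"
      using \<Delta> by (simp_all add: field_simps power2_eq_square mult_le_one)
    show ?thesis
    \<comment> \<open>From 2 on, rounding \<open>\<Delta> * d\<close> down loses at most half of it;
      below 2 the dimension is less than \<open>2 / \<Delta>\<close>, small enough for the Chow
      class.\<close>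
    proof (cases "\<Delta> * d < 2")
      case True
      then have "real d \<le> 2 * (1 / \<Delta>)" using \<Delta> by (simp add: field_simps)
      then have "real d + 2 \<le> 300 * (1 / \<Delta>\<^sup>2)" using sq by linarith
      then show ?thesis using learnable_mono[OF learnable_low_dim[OF eps n, of \<gamma>' \<gamma> d] rate[OF _ _ u1]] \<gamma> by simp
    next
      case False
      \<comment> \<open>With \<open>\<eta> = \<Delta> / 32\<close>, the required margin is
        \<open>6 * \<eta> * d = 3 / 16 * \<Delta> * d\<close>. The available one is at least
        \<open>\<Delta> * d / 4\<close>: rounding \<open>t\<close> costs at most half of
        \<open>\<Delta> * d\<close>, and the grid at most a quarter. The constant in
        \<open>k\<close> is 6 * 32^2 = 6144.\<close>
      define K where "K = nat \<lceil>4 * (1 / \<Delta>)\<rceil>"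
      define k where "k = nat \<lceil>6144 * (1 / \<Delta>\<^sup>2)\<rceil>"
      define t where "t = nat \<lfloor>\<Delta> * d\<rfloor>"
      have d: "d > 0" using False by (cases "d = 0") auto
      have ceil: "x \<le> nat \<lceil>x\<rceil>" "nat \<lceil>x\<rceil> \<le> x + 1" if "x \<ge> 0" for x :: real
        using that by linarith+
      have K: "4 * (1 / \<Delta>) \<le> K" "K \<le> 5 * (1 / \<Delta>)"
        using \<Delta> sq(2) ceil[of "4 * (1 / \<Delta>)"] unfolding K_def by (smt (verit))+
      have k: "6144 * (1 / \<Delta>\<^sup>2) \<le> k" "k \<le> 6145 * (1 / \<Delta>\<^sup>2)"
        using \<Delta> sq(3) ceil[of "6144 * (1 / \<Delta>\<^sup>2)"] unfolding k_def by (smt (verit))+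
      have t: "t \<le> \<Delta> * d" "\<Delta> * d - 1 \<le> t" using False unfolding t_def by linarith+
      have K0: "real K > 0" and k0: "real k > 0" using K(1) k(1) sq by linarith+
      have "d / K \<le> \<Delta> * d / 4"
      proof -
        have "1 / real K \<le> 1 / (4 / \<Delta>)" using K(1) \<Delta> K0 by (intro divide_left_mono) auto
        then have "1 / K * d \<le> \<Delta> / 4 * d" by (intro mult_right_mono) auto
        then show ?thesis by simp
      qed
      then have M: "6 * (\<Delta> / 32) * d < t - d / K" using t(2) False by linarith
      have \<eta>: "\<Delta> / 32 > 0" "6 \<le> (\<Delta> / 32)\<^sup>2 * k" using \<Delta> k(1) by (auto simp: field_simps power2_eq_square)
      define b where "b = k * (2 * real K + 1)"
      have "2 * real K + 1 \<le> 11 * (1 / \<Delta>)" using K(2) sq by linarith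
      also have "\<dots> \<le> 11 * (1 / \<Delta>\<^sup>2)" using sq by linarith
      finally have "b \<le> (6145 * (1 / \<Delta>\<^sup>2)) * (11 * (1 / \<Delta>\<^sup>2))"
        unfolding b_def using k(2) by (intro mult_mono) auto
      \<comment> \<open>Here 6145 * 11 = 67595 is at most 300^2.\<close>
      also have "\<dots> \<le> (300 * (1 / \<Delta>\<^sup>2))\<^sup>2"
        by (simp add: power2_eq_square divide_right_mono)
      finally have "sqrt b \<le> 300 * (1 / \<Delta>\<^sup>2)" by (intro real_le_lsqrt) auto
      moreover have b0: "b \<ge> 0" by (simp add: b_def)
      ultimately have "48 * sqrt b / (\<epsilon> * sqrt n) + 24 * b / (\<epsilon>\<^sup>2 * n) \<le> 2200000 * u"
        using rate[of "sqrt b", OF _ _ u1] by simp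
      then show ?thesis
        using learnable_mono[OF learnable_high_dim[OF eps n d _ _ \<eta> M _ _ b_def]] K0 k0 \<gamma> t(1)
        by (simp add: \<Delta>_def)
    qed
  qed
  then show ?thesis by (simp add: u_def \<Delta>_def)
qed

theorem theorem6p2:
  shows "\<exists>C>0. \<forall>(\<epsilon>::real) (\<gamma>::real) (\<gamma>'::real) (d::nat) (n::nat).
     0 < \<epsilon> \<and> \<epsilon> \<le> 1 \<and> 0 < \<gamma> \<and> \<gamma> \<le> 1 \<and> 0 < \<gamma>' \<and> \<gamma>' \<le> 1 \<and> \<gamma>' < \<gamma> \<and> 1 \<le> n \<longrightarrow>
     (\<exists>M :: (int list \<times> int) list \<Rightarrow> (int list \<Rightarrow> int) pmf.
        (\<forall>S. length S = n \<and> set S \<subseteq> recdom d \<longrightarrow> set_pmf (M S) \<subseteq> halfspaces d) \<and>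
        attr_dp \<epsilon> d n M \<and>
        (\<forall>D :: (int list \<times> int) pmf. set_pmf D \<subseteq> recdom d \<longrightarrow>
           measure_pmf.expectation (bind_pmf (replicate_pmf n D) M) (\<lambda>h. robust_err d \<gamma>' h D)
           \<le> (INF h\<in>halfspaces d. robust_err d \<gamma> h D)
              + C * (1 / (\<epsilon> * sqrt (real n) * (\<gamma> - \<gamma>')\<^sup>2)
                     + ln (1 / (\<gamma> - \<gamma>')) / (\<epsilon>\<^sup>2 * real n * (\<gamma> - \<gamma>')))))"
proof (rule exI[of _ 2200000], intro conjI allI impI, simp, elim conjE)
  fix \<epsilon> \<gamma> \<gamma>' :: real and d n :: nat
  assume a: "0 < \<epsilon>" "\<epsilon> \<le> 1" "0 < \<gamma>" "\<gamma> \<le> 1" "0 < \<gamma>'" "\<gamma>' \<le> 1" "\<gamma>' < \<gamma>" "1 \<le> n"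
  let ?u = "1 / (\<epsilon> * sqrt (real n) * (\<gamma> - \<gamma>')\<^sup>2)"
  let ?v = "ln (1 / (\<gamma> - \<gamma>')) / (\<epsilon>\<^sup>2 * real n * (\<gamma> - \<gamma>'))"
  \<comment> \<open>Since the gap is at most 1, the logarithmic term of the claimed bound is
    nonnegative and can be added to the bound already proved.\<close>
  have "ln (1 / (\<gamma> - \<gamma>')) \<ge> 0" using a by (intro ln_ge_zero) (simp add: field_simps)
  then have v: "?v \<ge> 0" using a by (intro divide_nonneg_nonneg) auto
  obtain M :: "(int list \<times> int) list \<Rightarrow> (int list \<Rightarrow> int) pmf" where
    M: "\<forall>S. length S = n \<and> set S \<subseteq> recdom d \<longrightarrow> set_pmf (M S) \<subseteq> halfspaces d" "attr_dp \<epsilon> d n M"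
    and err: "\<And>D h. set_pmf D \<subseteq> recdom d \<Longrightarrow> h \<in> halfspaces d \<Longrightarrow>
        measure_pmf.expectation (bind_pmf (replicate_pmf n D) M) (\<lambda>h. robust_err d \<gamma>' h D)
        \<le> robust_err d \<gamma> h D + 2200000 / (\<epsilon> * sqrt n * (\<gamma> - \<gamma>')\<^sup>2)"
    using learnable_bound[OF a(1,2,8,5,7,4), of d] unfolding learnable_def by auto
  have "measure_pmf.expectation (bind_pmf (replicate_pmf n D) M) (\<lambda>h. robust_err d \<gamma>' h D)
      \<le> (INF h\<in>halfspaces d. robust_err d \<gamma> h D) + 2200000 * (?u + ?v)"
    if D: "set_pmf D \<subseteq> recdom d" for D
  proof -
    let ?e = "measure_pmf.expectation (bind_pmf (replicate_pmf n D) M) (\<lambda>h. robust_err d \<gamma>' h D)"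
    have "?e - 2200000 * ?u \<le> (INF h\<in>halfspaces d. robust_err d \<gamma> h D)"
      using zero_halfspace_in[of d] err[OF D] by (intro cINF_greatest) (auto simp: algebra_simps)
    then show ?thesis using v unfolding distrib_left by linarith
  qed
  with M show "\<exists>M :: (int list \<times> int) list \<Rightarrow> (int list \<Rightarrow> int) pmf.
        (\<forall>S. length S = n \<and> set S \<subseteq> recdom d \<longrightarrow> set_pmf (M S) \<subseteq> halfspaces d) \<and>
        attr_dp \<epsilon> d n M \<and>
        (\<forall>D :: (int list \<times> int) pmf. set_pmf D \<subseteq> recdom d \<longrightarrow>
           measure_pmf.expectation (bind_pmf (replicate_pmf n D) M) (\<lambda>h. robust_err d \<gamma>' h D)
           \<le> (INF h\<in>halfspaces d. robust_err d \<gamma> h D) + 2200000 * (?u + ?v))"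
    by blast
qed

end
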